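(* Let $\mathcal{A}$ be a dual Banach algebra. If $\mathcal{A}$ is strong pseudo-amenable, then $\mathcal{A}$ is strong pseudo-Connes amenable.
   Context: A Banach algebra $\mathcal{A}$ is a dual Banach algebra if there is a closed submodule $\mathcal{A}_*$ of the dual bimodule $\mathcal{A}^*$ with $\mathcal{A}=(\mathcal{A}_* )^*$; the $wk^*$-topology on $\mathcal{A}$ is $\sigma(\mathcal{A},\mathcal{A}_* )$. For a Banach $\mathcal{A}$-bimodule $E$, $\sigma wc(E)$ is the closed submodule of all $x\in E$ such that the maps $\mathcal{A}\to E$, $a\mapsto a\cdot x$ and $a\mapsto x\cdot a$, are $wk^*$-$wk$-continuous. The projective tensor product $\mathcal{A}\hat\otimes\mathcal{A}$ is an $\mathcal{A}$-bimodule via $a\cdot(b\otimes c)=ab\otimes c$, $(b\otimes c)\cdot a=b\otimes ca$; duals carry the dual module actions. Write $\sigma wc(\mathcal{A}\hat\otimes\mathcal{A})^*$ for $\sigma wc((\mathcal{A}\hat\otimes\mathcal{A})^* )$. Let $\pi=\pi_{\mathcal{A}}:\mathcal{A}\hat\otimes\mathcal{A}\to\mathcal{A}$, $\pi(a\otimes b)=ab$. Then $\pi^*$ maps $\mathcal{A}_*$ into $\sigma wc(\mathcal{A}\hat\otimes\mathcal{A})^*$, and $\pi_{\sigma wc}:(\sigma wc(\mathcal{A}\hat\otimes\mathcal{A})^* )^*\to\mathcal{A}$ denotes the adjoint of $\pi^*|_{\mathcal{A}_*}$; it is an $\mathcal{A}$-bimodule morphism. $\mathcal{A}$ is strong pseudo-Connes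 amenable if there is a (not necessarily bounded) net $(m_\alpha)$ in $(\sigma wc(\mathcal{A}\hat\otimes\mathcal{A})^* )^*$ such that for every $a\in\mathcal{A}$: (i) $a\cdot m_\alpha-m_\alpha\cdot a\to0$ in the $wk^*$-topology of $(\sigma wc(\mathcal{A}\hat\otimes\mathcal{A})^* )^*$; (ii) $a\,\pi_{\sigma wc}(m_\alpha)=\pi_{\sigma wc}(m_\alpha)\,a$ for all $\alpha$, and $a\,\pi_{\sigma wc}(m_\alpha)\to a$ in the $wk^*$-topology of $\mathcal{A}$. A Banach algebra $\mathcal{A}$ is strong pseudo-amenable if there is a (not necessarily bounded) net $(m_\alpha)$ in $(\mathcal{A}\hat\otimes\mathcal{A})^{**}$ such that for every $a\in\mathcal{A}$, $a\cdot m_\alpha-m_\alpha\cdot a\to0$ in norm, $a\,\pi_{\mathcal{A}}^{**}(m_\alpha)=\pi_{\mathcal{A}}^{**}(m_\alpha)\,a$ for all $\alpha$, and $\pi_{\mathcal{A}}^{**}(m_\alpha)\,a\to a$ in norm. *)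

theory Defs
  imports "HOL-Analysis.Analysis" "HOL-Library.Poly_Mapping"
begin

section \<open>Complex Banach spaces and algebras\<close>

text \<open>HOL-Analysis only provides real normed spaces; the following classes add a complex scalar
  multiplication extending the real one.  Algebras are not required to have a unit.\<close>

class complex_normed_vector = real_normed_vector +
  fixes scaleC :: "complex \<Rightarrow> 'a \<Rightarrow> 'a"  (infixr \<open>*\<^sub>C\<close> 75)
  assumes scaleC_add_right: "c *\<^sub>C (x + y) = c *\<^sub>C x + c *\<^sub>C y"
    and scaleC_add_left: "(c + d) *\<^sub>C x = c *\<^sub>C x + d *\<^sub>C x"
    and scaleC_scaleC: "c *\<^sub>C (d *\<^sub>C x) = (c * d) *\<^sub>C x"
    and scaleC_of_real: "of_real r *\<^sub>C x = r *\<^sub>R x"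
    and norm_scaleC: "norm (c *\<^sub>C x) = cmod c * norm x"

class complex_banach = complex_normed_vector + complete_space

subclass (in complex_banach) banach ..

class complex_banach_algebra = complex_banach + real_normed_algebra +
  assumes scaleC_mult_left: "(c *\<^sub>C x) * y = c *\<^sub>C (x * y)"
    and scaleC_mult_right: "x * (c *\<^sub>C y) = c *\<^sub>C (x * y)"

instantiation complex :: complex_banach_algebra
begin

definition scaleC_complex :: "complex \<Rightarrow> complex \<Rightarrow> complex"
  where "scaleC_complex c x = c * x"

instance
  by standard (auto simp: scaleC_complex_def algebra_simps norm_mult scaleR_conv_of_real)

end

lemma scaleC_one [simp]: "1 *\<^sub>C x = (x :: 'a :: complex_normed_vector)"
  using scaleC_of_real[of 1 x] by simp

lemma scaleC_zero_left [simp]: "0 *\<^sub>C x = (0 :: 'a :: complex_normed_vector)"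
  using scaleC_of_real[of 0 x] by simp

lemma scaleC_minus_one: "(-1) *\<^sub>C x = - (x :: 'a :: complex_normed_vector)"
  using scaleC_of_real[of "-1" x] by simp

lemma scaleC_zero_right [simp]: "c *\<^sub>C 0 = (0 :: 'a :: complex_normed_vector)"
  using norm_scaleC[of c 0] by (metis mult_zero_right norm_eq_zero norm_zero)

lemma scaleC_minus_right: "c *\<^sub>C (- x) = - (c *\<^sub>C (x :: 'a :: complex_normed_vector))"
  by (metis add_eq_0_iff scaleC_add_right scaleC_zero_right add.right_inverse)

lemma scaleC_diff_right: "c *\<^sub>C (x - y) = c *\<^sub>C x - c *\<^sub>C (y :: 'a :: complex_normed_vector)"
  by (metis diff_conv_add_uminus scaleC_add_right scaleC_minus_right)

lemma scaleC_sum_right: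
  "c *\<^sub>C (\<Sum>i\<in>I. f i) = (\<Sum>i\<in>I. c *\<^sub>C (f i :: 'a :: complex_normed_vector))"
  by (induction I rule: infinite_finite_induct) (auto simp: scaleC_add_right)

lemma bounded_linear_scaleC_right: "bounded_linear (\<lambda>x. c *\<^sub>C (x :: 'a :: complex_normed_vector))"
  by (rule bounded_linear_intro[where K = "cmod c"])
     (auto simp: scaleC_add_right norm_scaleC scaleC_scaleC mult.commute simp flip: scaleC_of_real)

definition bounded_clinear ::
    "('a :: complex_normed_vector \<Rightarrow> 'b :: complex_normed_vector) \<Rightarrow> bool"
  where "bounded_clinear f \<longleftrightarrow> bounded_linear f \<and> (\<forall>c x. f (c *\<^sub>C x) = c *\<^sub>C f x)"

definition bounded_cbilinear ::
    "('a :: complex_normed_vector \<Rightarrow> 'b :: complex_normed_vector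
      \<Rightarrow> 'c :: complex_normed_vector) \<Rightarrow> bool"
  where "bounded_cbilinear f \<longleftrightarrow> bounded_bilinear f \<and>
    (\<forall>c x y. f (c *\<^sub>C x) y = c *\<^sub>C f x y \<and> f x (c *\<^sub>C y) = c *\<^sub>C f x y)"

definition csubspace :: "'a :: complex_normed_vector set \<Rightarrow> bool"
  where "csubspace S \<longleftrightarrow> 0 \<in> S \<and> (\<forall>x\<in>S. \<forall>y\<in>S. x + y \<in> S) \<and> (\<forall>c. \<forall>x\<in>S. c *\<^sub>C x \<in> S)"

lemma bounded_clinearI:
  fixes f :: "'a :: complex_normed_vector \<Rightarrow> 'b :: complex_normed_vector"
  assumes "\<And>x y. f (x + y) = f x + f y" "\<And>c x. f (c *\<^sub>C x) = c *\<^sub>C f x"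
    and "\<And>x. norm (f x) \<le> norm x * K"
  shows "bounded_clinear f"
  unfolding bounded_clinear_def
  using assms by (auto intro!: bounded_linear_intro[where K = K] simp flip: scaleC_of_real)

section \<open>The dual space\<close>

text \<open>Bounded complex linear functionals, with the operator norm of the real space of bounded
  linear maps into which they embed as a closed subspace.\<close>

typedef (overloaded) ('a :: complex_normed_vector) cdual =
    "{f :: 'a \<Rightarrow>\<^sub>L complex. \<forall>c x. blinfun_apply f (c *\<^sub>C x) = c * blinfun_apply f x}"
  by (rule exI[of _ 0]) auto

setup_lifting type_definition_cdual

lift_definition capply :: "'a :: complex_normed_vector cdual \<Rightarrow> 'a \<Rightarrow> complex" is blinfun_apply .

instantiation cdual :: (complex_normed_vector) complex_normed_vector
begin

lift_definition zero_cdual :: "'a cdual" is 0 by simp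
lift_definition plus_cdual :: "'a cdual \<Rightarrow> 'a cdual \<Rightarrow> 'a cdual" is "(+)"
  by (auto simp: blinfun.add_left algebra_simps)
lift_definition minus_cdual :: "'a cdual \<Rightarrow> 'a cdual \<Rightarrow> 'a cdual" is "(-)"
  by (auto simp: blinfun.diff_left algebra_simps)
lift_definition uminus_cdual :: "'a cdual \<Rightarrow> 'a cdual" is uminus
  by (auto simp: blinfun.minus_left)
lift_definition scaleR_cdual :: "real \<Rightarrow> 'a cdual \<Rightarrow> 'a cdual" is "(*\<^sub>R)"
  by (auto simp: blinfun.scaleR_left)
lift_definition scaleC_cdual :: "complex \<Rightarrow> 'a cdual \<Rightarrow> 'a cdual" is
  "\<lambda>c f. blinfun_compose (blinfun_mult_right c) f"
  by auto
lift_definition norm_cdual :: "'a cdual \<Rightarrow> real" is norm .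

definition dist_cdual :: "'a cdual \<Rightarrow> 'a cdual \<Rightarrow> real"
  where "dist_cdual x y = norm (x - y)"
definition sgn_cdual :: "'a cdual \<Rightarrow> 'a cdual"
  where "sgn_cdual x = scaleR (inverse (norm x)) x"
definition uniformity_cdual :: "('a cdual \<times> 'a cdual) filter"
  where "uniformity_cdual = (INF e\<in>{0 <..}. principal {(x, y). dist x y < e})"
definition open_cdual :: "'a cdual set \<Rightarrow> bool"
  where "open_cdual S = (\<forall>x\<in>S. \<forall>\<^sub>F (x', y) in uniformity. x' = x \<longrightarrow> y \<in> S)"

instance
proof
  fix c :: complex and x :: "'a cdual"
  show "norm (c *\<^sub>C x) = cmod c * norm x"
  proof transfer
    fix c :: complex and x :: "'a \<Rightarrow>\<^sub>L complex"
    assume *: "\<forall>c y. blinfun_apply x (c *\<^sub>C y) = c * blinfun_apply x y"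
    have le: "norm (blinfun_mult_right c o\<^sub>L y) \<le> cmod c * norm y" for c and y :: "'a \<Rightarrow>\<^sub>L complex"
      by (rule norm_blinfun_bound)
         (auto simp: norm_mult mult.assoc intro!: mult_left_mono norm_blinfun)
    show "norm (blinfun_mult_right c o\<^sub>L x) = cmod c * norm x"
    proof (cases "c = 0")
      case True
      then show ?thesis using le[of 0 x] by auto
    next
      case False
      have "x = blinfun_mult_right (inverse c) o\<^sub>L (blinfun_mult_right c o\<^sub>L x)"
        using False by (intro blinfun_eqI) auto
      then have "norm x \<le> cmod (inverse c) * norm (blinfun_mult_right c o\<^sub>L x)"
        using le by metis
      then have "cmod c * norm x \<le> norm (blinfun_mult_right c o\<^sub>L x)"
        using False by (simp add: norm_inverse norm_divide field_simps)
      then show ?thesis using le[of c x] by linarith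
    qed
  qed
qed (unfold dist_cdual_def open_cdual_def sgn_cdual_def uniformity_cdual_def,
     (rule refl | (transfer, force intro!: blinfun_eqI
        simp: algebra_simps blinfun.add_left blinfun.add_right blinfun.scaleR_left
          scaleR_conv_of_real norm_triangle_ineq))+)

end

lemma capply_simps [simp]:
  "capply 0 x = 0"
  "capply (f + g) x = capply f x + capply g x"
  "capply (f - g) x = capply f x - capply g x"
  "capply (- f) x = - capply f x"
  "capply (c *\<^sub>C f) x = c * capply f x"
  by (transfer, auto simp: blinfun.add_left blinfun.diff_left blinfun.minus_left)+

lemma cdual_eqI: "(\<And>x. capply f x = capply g x) \<Longrightarrow> f = g"
  by transfer (auto intro: blinfun_eqI)

lemma bounded_clinear_capply: "bounded_clinear (capply f)"
  unfolding bounded_clinear_def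
  by transfer (auto simp: scaleC_complex_def blinfun.bounded_linear_right)

lemma norm_capply: "cmod (capply f x) \<le> norm f * norm x"
  by transfer (rule norm_blinfun)

instance cdual :: (complex_normed_vector) complex_banach
proof
  fix X :: "nat \<Rightarrow> 'a cdual" assume "Cauchy X"
  then have "Cauchy (\<lambda>n. Rep_cdual (X n))"
    unfolding Cauchy_def dist_norm by transfer
  then obtain L where L: "(\<lambda>n. Rep_cdual (X n)) \<longlonglongrightarrow> L"
    using Cauchy_convergent convergent_def by blast
  have "blinfun_apply L (c *\<^sub>C x) = c * blinfun_apply L x" for c x
  proof -
    have ptw: "(\<lambda>n. capply (X n) y) \<longlonglongrightarrow> blinfun_apply L y" for y
      unfolding capply.rep_eq using L by (intro tendsto_intros)
    have "(\<lambda>n. capply (X n) (c *\<^sub>C x)) \<longlonglongrightarrow> c * blinfun_apply L x"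
      using tendsto_mult_left[OF ptw[of x], of c] Rep_cdual[of "X n" for n]
      unfolding capply.rep_eq mem_Collect_eq by simp
    with ptw[of "c *\<^sub>C x"] show ?thesis
      using LIMSEQ_unique by blast
  qed
  then have L': "Rep_cdual (Abs_cdual L) = L"
    by (intro Abs_cdual_inverse) auto
  have "X \<longlonglongrightarrow> Abs_cdual L"
    using L unfolding tendsto_iff dist_norm minus_cdual.rep_eq norm_cdual.rep_eq L' by simp
  then show "convergent X" by (auto simp: convergent_def)
qed

text \<open>The functional with the given values; meaningful for bounded complex linear arguments.\<close>

definition cdual_of :: "('a :: complex_normed_vector \<Rightarrow> complex) \<Rightarrow> 'a cdual"
  where "cdual_of f = Abs_cdual (Blinfun f)"

lemma capply_cdual_of: "bounded_clinear f \<Longrightarrow> capply (cdual_of f) x = f x"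
  unfolding cdual_of_def bounded_clinear_def capply.rep_eq
  by (subst Abs_cdual_inverse) (auto simp: bounded_linear_Blinfun_apply scaleC_complex_def)

definition cadjoint ::
    "('a :: complex_normed_vector \<Rightarrow> 'b :: complex_normed_vector) \<Rightarrow> 'b cdual \<Rightarrow> 'a cdual"
  where "cadjoint T \<phi> = cdual_of (\<lambda>x. capply \<phi> (T x))"

definition to_bidual :: "'a :: complex_normed_vector \<Rightarrow> 'a cdual cdual"
  where "to_bidual x = cdual_of (\<lambda>\<phi>. capply \<phi> x)"

lemma bounded_clinear_compose:
  "bounded_clinear f \<Longrightarrow> bounded_clinear g \<Longrightarrow> bounded_clinear (\<lambda>x. f (g x))"
  unfolding bounded_clinear_def by (auto intro: bounded_linear_compose)

lemma capply_cadjoint: "bounded_clinear T \<Longrightarrow> capply (cadjoint T \<phi>) x = capply \<phi> (T x)"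
  unfolding cadjoint_def
  by (intro capply_cdual_of bounded_clinear_compose[OF bounded_clinear_capply])

lemma capply_to_bidual: "capply (to_bidual x) \<phi> = capply \<phi> x"
  unfolding to_bidual_def
  by (intro capply_cdual_of bounded_clinearI[where K = "norm x"])
     (auto simp: scaleC_complex_def norm_capply)

section \<open>The projective tensor product\<close>

text \<open>The algebraic tensor product is the space of finitely supported functions
  \<open>'a \<times> 'b \<Rightarrow>\<^sub>0 complex\<close> (formal linear combinations of pairs) modulo \<open>tensor_null\<close>.\<close>

definition formal_scale :: "complex \<Rightarrow> ('k \<Rightarrow>\<^sub>0 complex) \<Rightarrow> ('k \<Rightarrow>\<^sub>0 complex)"
  where "formal_scale c u = Poly_Mapping.map ((*) c) u"

abbreviation formal_pair :: "'a \<Rightarrow> 'b \<Rightarrow> ('a \<times> 'b \<Rightarrow>\<^sub>0 complex)"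
  where "formal_pair a b \<equiv> Poly_Mapping.single (a, b) 1"

definition tensor_null ::
    "('a :: complex_normed_vector \<times> 'b :: complex_normed_vector \<Rightarrow>\<^sub>0 complex) set"
  where "tensor_null = module.span formal_scale
     ({formal_pair (a + a') b - formal_pair a b - formal_pair a' b | a a' b. True} \<union>
      {formal_pair a (b + b') - formal_pair a b - formal_pair a b' | a b b'. True} \<union>
      {formal_pair (c *\<^sub>C a) b - formal_scale c (formal_pair a b) | a b c. True} \<union>
      {formal_pair a (c *\<^sub>C b) - formal_scale c (formal_pair a b) | a b c. True})"

text \<open>The infimum of \<open>\<Sum> \<parallel>a\<^sub>i\<parallel> \<parallel>b\<^sub>i\<parallel>\<close> over all representations \<open>u = \<Sum> a\<^sub>i \<otimes> b\<^sub>i\<close> in the algebraic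
  tensor product.\<close>

definition proj_norm ::
    "('a :: complex_normed_vector \<times> 'b :: complex_normed_vector \<Rightarrow>\<^sub>0 complex) \<Rightarrow> real"
  where "proj_norm u = Inf {(\<Sum>(a, b)\<leftarrow>xs. norm a * norm b) | xs.
           u - (\<Sum>(a, b)\<leftarrow>xs. formal_pair a b) \<in> tensor_null}"

text \<open>The completion: Cauchy sequences for the projective norm modulo null sequences.  Elements
  of \<open>tensor_null\<close> have \<open>proj_norm\<close> zero, so the passage to the algebraic tensor product is
  subsumed in the quotient by null sequences.\<close>

definition proj_Cauchy ::
    "(nat \<Rightarrow> 'a :: complex_normed_vector \<times> 'b :: complex_normed_vector \<Rightarrow>\<^sub>0 complex) \<Rightarrow> bool"
  where "proj_Cauchy X \<longleftrightarrow> (\<forall>e>0. \<exists>N. \<forall>m\<ge>N. \<forall>n\<ge>N. proj_norm (X m - X n) < e)"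

definition ptensor_rel ::
    "(nat \<Rightarrow> 'a :: complex_normed_vector \<times> 'b :: complex_normed_vector \<Rightarrow>\<^sub>0 complex)
     \<Rightarrow> (nat \<Rightarrow> 'a \<times> 'b \<Rightarrow>\<^sub>0 complex) \<Rightarrow> bool"
  where "ptensor_rel X Y \<longleftrightarrow>
    proj_Cauchy X \<and> proj_Cauchy Y \<and> (\<lambda>n. proj_norm (X n - Y n)) \<longlonglongrightarrow> 0"

lemma lookup_formal_scale [simp]:
  "Poly_Mapping.lookup (formal_scale c u) k = c * Poly_Mapping.lookup u k"
  unfolding formal_scale_def by (auto simp: Poly_Mapping.map.rep_eq when_def)

interpretation formal: module formal_scale
  by standard (auto intro!: poly_mapping_eqI simp: lookup_add algebra_simps)

lemma tensor_null_0: "0 \<in> tensor_null"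
  and tensor_null_add: "u \<in> tensor_null \<Longrightarrow> v \<in> tensor_null \<Longrightarrow> u + v \<in> tensor_null"
  and tensor_null_scale: "u \<in> tensor_null \<Longrightarrow> formal_scale c u \<in> tensor_null"
  unfolding tensor_null_def
  by (auto intro: formal.span_zero formal.span_add formal.span_scale)

lemma tensor_null_rels:
  "formal_pair (a + a') b - formal_pair a b - formal_pair a' b \<in> tensor_null"
  "formal_pair a (b + b') - formal_pair a b - formal_pair a b' \<in> tensor_null"
  "formal_pair (c *\<^sub>C a) b - formal_scale c (formal_pair a b) \<in> tensor_null"
  "formal_pair a (c *\<^sub>C b) - formal_scale c (formal_pair a b) \<in> tensor_null"
  unfolding tensor_null_def by (rule formal.span_base; blast)+

lemma formal_scale_pairs:
  "formal_scale c (\<Sum>(a, b)\<leftarrow>xs. formal_pair a b) -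
     (\<Sum>(a, b)\<leftarrow>map (\<lambda>(a, b). (c *\<^sub>C a, b)) xs. formal_pair a b) \<in> tensor_null"
proof (induction xs)
  case Nil
  then show ?case by (simp add: tensor_null_0)
next
  case (Cons x xs)
  obtain a b where x: "x = (a, b)" by fastforce
  have "formal_scale (-1) (formal_pair (c *\<^sub>C a) b - formal_scale c (formal_pair a b)) \<in> tensor_null"
    by (intro tensor_null_scale tensor_null_rels)
  from tensor_null_add[OF this Cons.IH] show ?case
    unfolding x by (simp add: algebra_simps)
qed

lemma formal_repr: "\<exists>xs. u - (\<Sum>(a, b)\<leftarrow>xs. formal_pair a b) \<in> tensor_null"
proof (induction u rule: Poly_Mapping.update_induct)
  case const
  show ?case by (rule exI[of _ "[]"]) (simp add: tensor_null_0)
next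
  case (update f k c)
  then obtain xs where xs: "f - (\<Sum>(a, b)\<leftarrow>xs. formal_pair a b) \<in> tensor_null" by blast
  obtain a b where k: "k = (a, b)" by fastforce
  have upd: "Poly_Mapping.update k c f = formal_scale c (formal_pair a b) + f"
    using update(1) unfolding k
    by (intro poly_mapping_eqI)
       (auto simp: lookup_add lookup_update lookup_single when_def in_keys_iff)
  have "formal_scale (-1) (formal_pair (c *\<^sub>C a) b - formal_scale c (formal_pair a b)) \<in> tensor_null"
    by (intro tensor_null_scale tensor_null_rels)
  from tensor_null_add[OF this xs]
  have "Poly_Mapping.update k c f - (\<Sum>(a, b)\<leftarrow>(c *\<^sub>C a, b) # xs. formal_pair a b) \<in> tensor_null"
    unfolding upd by (simp add: algebra_simps)
  then show ?case by blast
qed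

lemma pair_weight_nonneg:
  "0 \<le> (\<Sum>(a, b)\<leftarrow>xs. norm (a :: 'a :: real_normed_vector) * norm (b :: 'b :: real_normed_vector))"
  by (rule sum_list_nonneg) auto

lemma proj_norm_le:
  assumes "u - (\<Sum>(a, b)\<leftarrow>xs. formal_pair a b) \<in> tensor_null"
  shows "proj_norm u \<le> (\<Sum>(a, b)\<leftarrow>xs. norm a * norm b)"
  unfolding proj_norm_def
  by (rule cInf_lower) (use assms in \<open>auto intro!: bdd_belowI[where m = 0] simp: pair_weight_nonneg\<close>)

lemma proj_norm_approx:
  assumes "proj_norm u < e"
  obtains xs where "u - (\<Sum>(a, b)\<leftarrow>xs. formal_pair a b) \<in> tensor_null"
    "(\<Sum>(a, b)\<leftarrow>xs. norm a * norm b) < e"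
proof -
  have "{(\<Sum>(a, b)\<leftarrow>xs. norm a * norm b) | xs.
      u - (\<Sum>(a, b)\<leftarrow>xs. formal_pair a b) \<in> tensor_null} \<noteq> {}"
    using formal_repr[of u] by auto
  from cInf_lessD[OF this] assms that show thesis
    unfolding proj_norm_def by blast
qed

lemma proj_norm_nonneg: "0 \<le> proj_norm u"
proof (rule ccontr)
  assume "\<not> 0 \<le> proj_norm u"
  then have "proj_norm u < 0" by simp
  from proj_norm_approx[OF this] pair_weight_nonneg show False
    by (metis not_le)
qed

lemma proj_norm_pair_le: "proj_norm (formal_pair a b) \<le> norm a * norm b"
  using proj_norm_le[of "formal_pair a b" "[(a, b)]"] by (simp add: tensor_null_0)

lemma proj_norm_null: "u \<in> tensor_null \<Longrightarrow> proj_norm u = 0"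
  using proj_norm_le[of u "[]"] proj_norm_nonneg[of u] by simp

lemma proj_norm_0 [simp]: "proj_norm 0 = 0"
  by (rule proj_norm_null[OF tensor_null_0])

lemma proj_norm_add: "proj_norm (u + v) \<le> proj_norm u + proj_norm v"
proof (rule field_le_epsilon)
  fix e :: real assume e: "0 < e"
  obtain xs where xs: "u - (\<Sum>(a, b)\<leftarrow>xs. formal_pair a b) \<in> tensor_null"
    "(\<Sum>(a, b)\<leftarrow>xs. norm a * norm b) < proj_norm u + e/2"
    using proj_norm_approx[of u "proj_norm u + e/2"] e by auto
  obtain ys where ys: "v - (\<Sum>(a, b)\<leftarrow>ys. formal_pair a b) \<in> tensor_null"
    "(\<Sum>(a, b)\<leftarrow>ys. norm a * norm b) < proj_norm v + e/2"
    using proj_norm_approx[of v "proj_norm v + e/2"] e by auto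
  have "(u + v) - (\<Sum>(a, b)\<leftarrow>xs @ ys. formal_pair a b) \<in> tensor_null"
    using tensor_null_add[OF xs(1) ys(1)] by (simp add: algebra_simps)
  from proj_norm_le[OF this] xs(2) ys(2)
  show "proj_norm (u + v) \<le> proj_norm u + proj_norm v + e" by simp
qed

lemma proj_norm_scale_le: "proj_norm (formal_scale c u) \<le> cmod c * proj_norm u"
proof (rule field_le_epsilon)
  fix e :: real assume e: "0 < e"
  define d where "d = e / (cmod c + 1)"
  have d: "d > 0" "cmod c * d \<le> e"
    using e by (auto simp: d_def field_simps add_pos_nonneg add_nonneg_pos)
  obtain xs where xs: "u - (\<Sum>(a, b)\<leftarrow>xs. formal_pair a b) \<in> tensor_null"
    "(\<Sum>(a, b)\<leftarrow>xs. norm a * norm b) < proj_norm u + d"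
    using proj_norm_approx[of u "proj_norm u + d"] d by auto
  let ?ys = "map (\<lambda>(a, b). (c *\<^sub>C a, b)) xs"
  have "formal_scale c u - (\<Sum>(a, b)\<leftarrow>?ys. formal_pair a b) \<in> tensor_null"
    using tensor_null_add[OF tensor_null_scale[OF xs(1), of c] formal_scale_pairs[of c xs]]
    by (simp add: formal.scale_right_diff_distrib)
  from proj_norm_le[OF this]
  have "proj_norm (formal_scale c u) \<le> (\<Sum>(a, b)\<leftarrow>?ys. norm a * norm b)" .
  also have "\<dots> = cmod c * (\<Sum>(a, b)\<leftarrow>xs. norm a * norm b)"
    by (induction xs) (auto simp: norm_scaleC algebra_simps)
  also have "\<dots> \<le> cmod c * (proj_norm u + d)"
    using xs(2) by (intro mult_left_mono) auto
  also have "\<dots> \<le> cmod c * proj_norm u + e"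
    using d by (simp add: algebra_simps)
  finally show "proj_norm (formal_scale c u) \<le> cmod c * proj_norm u + e" .
qed

lemma proj_norm_scale: "proj_norm (formal_scale c u) = cmod c * proj_norm u"
proof (cases "c = 0")
  case True
  then show ?thesis by simp
next
  case False
  have "proj_norm (formal_scale (inverse c) (formal_scale c u))
      \<le> cmod (inverse c) * proj_norm (formal_scale c u)"
    by (rule proj_norm_scale_le)
  then have "cmod c * proj_norm u \<le> proj_norm (formal_scale c u)"
    using False by (simp add: norm_inverse norm_divide field_simps)
  with proj_norm_scale_le[of c u] show ?thesis by linarith
qed

lemma proj_norm_uminus: "proj_norm (- u) = proj_norm u"
  using proj_norm_scale[of "-1" u] by simp

lemma proj_norm_minus_commute: "proj_norm (u - v) = proj_norm (v - u)"
  using proj_norm_uminus[of "u - v"] by simp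

lemma proj_norm_triangle: "proj_norm (u - w) \<le> proj_norm (u - v) + proj_norm (v - w)"
  using proj_norm_add[of "u - v" "v - w"] by simp

lemma proj_norm_diff: "\<bar>proj_norm u - proj_norm v\<bar> \<le> proj_norm (u - v)"
  using proj_norm_add[of "u - v" v] proj_norm_add[of "v - u" u] proj_norm_minus_commute[of u v]
  by simp

lemma tendsto_0_le:
  fixes f g :: "nat \<Rightarrow> real"
  assumes "\<And>n. 0 \<le> f n" "\<And>n. f n \<le> g n" "g \<longlonglongrightarrow> 0"
  shows "f \<longlonglongrightarrow> 0"
  by (rule tendsto_sandwich[OF _ _ tendsto_const assms(3)]) (use assms in auto)

lemma proj_Cauchy_const: "proj_Cauchy (\<lambda>_. u)"
  by (auto simp: proj_Cauchy_def)

lemma proj_Cauchy_add: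
  assumes "proj_Cauchy X" "proj_Cauchy Y"
  shows "proj_Cauchy (\<lambda>n. X n + Y n)"
  unfolding proj_Cauchy_def
proof (intro allI impI)
  fix e :: real assume "e > 0"
  then obtain M N where
    M: "\<And>m n. m \<ge> M \<Longrightarrow> n \<ge> M \<Longrightarrow> proj_norm (X m - X n) < e/2" and
    N: "\<And>m n. m \<ge> N \<Longrightarrow> n \<ge> N \<Longrightarrow> proj_norm (Y m - Y n) < e/2"
    using assms unfolding proj_Cauchy_def by (metis half_gt_zero)
  have "proj_norm (X m + Y m - (X n + Y n)) < e" if "m \<ge> max M N" "n \<ge> max M N" for m n
    using proj_norm_add[of "X m - X n" "Y m - Y n"] M[of m n] N[of m n] that
    by (simp add: algebra_simps)
  then show "\<exists>N. \<forall>m\<ge>N. \<forall>n\<ge>N. proj_norm (X m + Y m - (X n + Y n)) < e" by blast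
qed

lemma proj_Cauchy_scale:
  assumes "proj_Cauchy X"
  shows "proj_Cauchy (\<lambda>n. formal_scale c (X n))"
  unfolding proj_Cauchy_def
proof (intro allI impI)
  fix e :: real assume e: "e > 0"
  define d where "d = e / (cmod c + 1)"
  have d: "d > 0" using e by (auto simp: d_def add_nonneg_pos)
  then obtain N where N: "\<And>m n. m \<ge> N \<Longrightarrow> n \<ge> N \<Longrightarrow> proj_norm (X m - X n) < d"
    using assms unfolding proj_Cauchy_def by blast
  have "proj_norm (formal_scale c (X m) - formal_scale c (X n)) < e" if "m \<ge> N" "n \<ge> N" for m n
  proof -
    have "proj_norm (formal_scale c (X m) - formal_scale c (X n)) = cmod c * proj_norm (X m - X n)"
      by (simp add: proj_norm_scale flip: formal.scale_right_diff_distrib)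
    also have "\<dots> \<le> cmod c * d" using N[OF that] by (intro mult_left_mono) auto
    also have "\<dots> < e"
    proof -
      have "cmod c + 1 > 0" by (simp add: add_nonneg_pos)
      then show ?thesis using e by (simp add: d_def field_simps)
    qed
    finally show ?thesis .
  qed
  then show "\<exists>N. \<forall>m\<ge>N. \<forall>n\<ge>N. proj_norm (formal_scale c (X m) - formal_scale c (X n)) < e" by blast
qed

lemma proj_Cauchy_uminus: "proj_Cauchy X \<Longrightarrow> proj_Cauchy (\<lambda>n. - X n)"
  using proj_Cauchy_scale[of X "-1"] by simp

lemma proj_Cauchy_diff: "proj_Cauchy X \<Longrightarrow> proj_Cauchy Y \<Longrightarrow> proj_Cauchy (\<lambda>n. X n - Y n)"
  using proj_Cauchy_add[of X "\<lambda>n. - Y n"] proj_Cauchy_uminus[of Y] by simp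

lemma ptensor_rel_add:
  assumes "ptensor_rel X X'" "ptensor_rel Y Y'"
  shows "ptensor_rel (\<lambda>n. X n + Y n) (\<lambda>n. X' n + Y' n)"
proof -
  have "(\<lambda>n. proj_norm (X n + Y n - (X' n + Y' n))) \<longlonglongrightarrow> 0"
  proof (rule tendsto_0_le)
    show "(\<lambda>n. proj_norm (X n - X' n) + proj_norm (Y n - Y' n)) \<longlonglongrightarrow> 0"
      using assms unfolding ptensor_rel_def by (auto intro: tendsto_add_zero)
    show "proj_norm (X n + Y n - (X' n + Y' n)) \<le> proj_norm (X n - X' n) + proj_norm (Y n - Y' n)"
      for n using proj_norm_add[of "X n - X' n" "Y n - Y' n"] by (simp add: algebra_simps)
  qed (rule proj_norm_nonneg)
  then show ?thesis using assms unfolding ptensor_rel_def by (auto intro: proj_Cauchy_add)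
qed

lemma ptensor_rel_scale:
  assumes "ptensor_rel X X'"
  shows "ptensor_rel (\<lambda>n. formal_scale c (X n)) (\<lambda>n. formal_scale c (X' n))"
proof -
  have "(\<lambda>n. cmod c * proj_norm (X n - X' n)) \<longlonglongrightarrow> 0"
    using assms unfolding ptensor_rel_def by (auto intro: tendsto_mult_right_zero)
  then show ?thesis using assms unfolding ptensor_rel_def
    by (auto intro: proj_Cauchy_scale simp: proj_norm_scale simp flip: formal.scale_right_diff_distrib)
qed

lemma ptensor_rel_uminus: "ptensor_rel X X' \<Longrightarrow> ptensor_rel (\<lambda>n. - X n) (\<lambda>n. - X' n)"
  using ptensor_rel_scale[of X X' "-1"] by simp

lemma ptensor_rel_diff:
  "ptensor_rel X X' \<Longrightarrow> ptensor_rel Y Y' \<Longrightarrow> ptensor_rel (\<lambda>n. X n - Y n) (\<lambda>n. X' n - Y' n)"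
  using ptensor_rel_add[of X X' "\<lambda>n. - Y n" "\<lambda>n. - Y' n"] ptensor_rel_uminus[of Y Y'] by simp

lemma proj_Cauchy_norm_convergent:
  assumes "proj_Cauchy X"
  shows "convergent (\<lambda>n. proj_norm (X n))"
  unfolding Cauchy_convergent_iff[symmetric]
proof (rule metric_CauchyI)
  fix e :: real assume "e > 0"
  then obtain N where "\<And>m n. m \<ge> N \<Longrightarrow> n \<ge> N \<Longrightarrow> proj_norm (X m - X n) < e"
    using assms unfolding proj_Cauchy_def by blast
  then show "\<exists>N. \<forall>m\<ge>N. \<forall>n\<ge>N. dist (proj_norm (X m)) (proj_norm (X n)) < e"
    unfolding dist_real_def using proj_norm_diff by (meson le_less_trans)
qed

lemma ptensor_rel_norm:
  assumes "ptensor_rel X Y"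
  shows "lim (\<lambda>n. proj_norm (X n)) = lim (\<lambda>n. proj_norm (Y n))"
proof -
  have "(\<lambda>n. \<bar>proj_norm (X n) - proj_norm (Y n)\<bar>) \<longlonglongrightarrow> 0"
    by (rule tendsto_0_le[where g = "\<lambda>n. proj_norm (X n - Y n)"])
       (use assms in \<open>auto simp: ptensor_rel_def proj_norm_diff\<close>)
  then have "(\<lambda>n. proj_norm (X n) - proj_norm (Y n)) \<longlonglongrightarrow> 0"
    by (simp add: tendsto_rabs_zero_iff)
  moreover obtain l where "(\<lambda>n. proj_norm (Y n)) \<longlonglongrightarrow> l"
    using assms proj_Cauchy_norm_convergent by (auto simp: ptensor_rel_def convergent_def)
  ultimately have "(\<lambda>n. proj_norm (X n)) \<longlonglongrightarrow> l" "(\<lambda>n. proj_norm (Y n)) \<longlonglongrightarrow> l"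
    using tendsto_add by fastforce+
  then show ?thesis by (simp add: limI)
qed

lifting_forget poly_mapping.lifting

quotient_type (overloaded) ('a, 'b) ptensor =
    "nat \<Rightarrow> 'a :: complex_normed_vector \<times> 'b :: complex_normed_vector \<Rightarrow>\<^sub>0 complex"
    / partial: ptensor_rel
proof (rule part_equivpI)
  show "\<exists>X :: nat \<Rightarrow> 'a \<times> 'b \<Rightarrow>\<^sub>0 complex. ptensor_rel X X"
    by (rule exI[of _ "\<lambda>_. 0"]) (auto simp: ptensor_rel_def proj_Cauchy_const)
  show "symp (ptensor_rel :: (nat \<Rightarrow> 'a \<times> 'b \<Rightarrow>\<^sub>0 complex) \<Rightarrow> _)"
    by (auto intro!: sympI simp: ptensor_rel_def proj_norm_minus_commute)
  show "transp (ptensor_rel :: (nat \<Rightarrow> 'a \<times> 'b \<Rightarrow>\<^sub>0 complex) \<Rightarrow> _)"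
  proof (rule transpI)
    fix X Y Z :: "nat \<Rightarrow> 'a \<times> 'b \<Rightarrow>\<^sub>0 complex"
    assume *: "ptensor_rel X Y" "ptensor_rel Y Z"
    have "(\<lambda>n. proj_norm (X n - Z n)) \<longlonglongrightarrow> 0"
    proof (rule tendsto_0_le)
      show "(\<lambda>n. proj_norm (X n - Y n) + proj_norm (Y n - Z n)) \<longlonglongrightarrow> 0"
        using * unfolding ptensor_rel_def by (auto intro: tendsto_add_zero)
    qed (auto intro: proj_norm_nonneg proj_norm_triangle)
    then show "ptensor_rel X Z" using * by (auto simp: ptensor_rel_def)
  qed
qed

instantiation ptensor :: (complex_normed_vector, complex_normed_vector) complex_normed_vector
begin

lift_definition zero_ptensor :: "('a, 'b) ptensor" is "\<lambda>_. 0"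
  by (simp add: ptensor_rel_def proj_Cauchy_const)
lift_definition plus_ptensor :: "('a, 'b) ptensor \<Rightarrow> ('a, 'b) ptensor \<Rightarrow> ('a, 'b) ptensor"
  is "\<lambda>X Y n. X n + Y n" by (rule ptensor_rel_add)
lift_definition minus_ptensor :: "('a, 'b) ptensor \<Rightarrow> ('a, 'b) ptensor \<Rightarrow> ('a, 'b) ptensor"
  is "\<lambda>X Y n. X n - Y n" by (rule ptensor_rel_diff)
lift_definition uminus_ptensor :: "('a, 'b) ptensor \<Rightarrow> ('a, 'b) ptensor"
  is "\<lambda>X n. - X n" by (rule ptensor_rel_uminus)
lift_definition scaleC_ptensor :: "complex \<Rightarrow> ('a, 'b) ptensor \<Rightarrow> ('a, 'b) ptensor"
  is "\<lambda>c X n. formal_scale c (X n)" by (rule ptensor_rel_scale)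
lift_definition scaleR_ptensor :: "real \<Rightarrow> ('a, 'b) ptensor \<Rightarrow> ('a, 'b) ptensor"
  is "\<lambda>r X n. formal_scale (of_real r) (X n)" by (rule ptensor_rel_scale)
lift_definition norm_ptensor :: "('a, 'b) ptensor \<Rightarrow> real"
  is "\<lambda>X. lim (\<lambda>n. proj_norm (X n))" by (rule ptensor_rel_norm)

definition dist_ptensor :: "('a, 'b) ptensor \<Rightarrow> ('a, 'b) ptensor \<Rightarrow> real"
  where "dist_ptensor x y = norm (x - y)"
definition sgn_ptensor :: "('a, 'b) ptensor \<Rightarrow> ('a, 'b) ptensor"
  where "sgn_ptensor x = scaleR (inverse (norm x)) x"
definition uniformity_ptensor :: "(('a, 'b) ptensor \<times> ('a, 'b) ptensor) filter"
  where "uniformity_ptensor = (INF e\<in>{0 <..}. principal {(x, y). dist x y < e})"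
definition open_ptensor :: "('a, 'b) ptensor set \<Rightarrow> bool"
  where "open_ptensor S = (\<forall>x\<in>S. \<forall>\<^sub>F (x', y) in uniformity. x' = x \<longrightarrow> y \<in> S)"

instance
proof
  have rel: "ptensor_rel X Y" if "proj_Cauchy X" "\<And>n. X n = Y n"
    for X Y :: "nat \<Rightarrow> 'a \<times> 'b \<Rightarrow>\<^sub>0 complex"
  proof -
    have "X = Y" using that(2) by (rule ext)
    with that(1) show ?thesis by (simp add: ptensor_rel_def)
  qed
  have refl: "ptensor_rel X X \<longleftrightarrow> proj_Cauchy X" for X :: "nat \<Rightarrow> 'a \<times> 'b \<Rightarrow>\<^sub>0 complex"
    by (simp add: ptensor_rel_def)
  note intros = rel proj_Cauchy_add proj_Cauchy_diff proj_Cauchy_scale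
  have nrm: "(\<lambda>n. proj_norm (X n)) \<longlonglongrightarrow> lim (\<lambda>n. proj_norm (X n))" if "ptensor_rel X X"
    for X :: "nat \<Rightarrow> 'a \<times> 'b \<Rightarrow>\<^sub>0 complex"
    using that proj_Cauchy_norm_convergent by (auto simp: ptensor_rel_def convergent_LIMSEQ_iff)
  fix x y z :: "('a, 'b) ptensor" and a b :: real and c d :: complex
  show "x + y + z = x + (y + z)"
    by transfer (auto intro!: intros simp: refl add.assoc)
  show "x + y = y + x"
    by transfer (auto intro!: intros simp: refl add.commute)
  show "0 + x = x"
    by transfer simp
  show "- x + x = 0"
    by transfer (simp add: ptensor_rel_def proj_Cauchy_const)
  show "x - y = x + - y"
    by transfer (auto intro!: intros simp: refl)
  show "a *\<^sub>R (x + y) = a *\<^sub>R x + a *\<^sub>R y"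
    by transfer (auto intro!: intros simp: refl formal.scale_right_distrib)
  show "(a + b) *\<^sub>R x = a *\<^sub>R x + b *\<^sub>R x"
    by transfer (auto intro!: intros simp: refl formal.scale_left_distrib)
  show "a *\<^sub>R b *\<^sub>R x = (a * b) *\<^sub>R x"
    by transfer (auto intro!: intros simp: refl)
  show "1 *\<^sub>R x = x"
    by transfer simp
  show "dist x y = norm (x - y)" by (rule dist_ptensor_def)
  show "sgn x = scaleR (inverse (norm x)) x" by (rule sgn_ptensor_def)
  show "uniformity = (INF e\<in>{0 <..}. principal {(x, y :: ('a, 'b) ptensor). dist x y < e})"
    by (rule uniformity_ptensor_def)
  show "open S = (\<forall>x\<in>S. \<forall>\<^sub>F (x', y) in uniformity. x' = x \<longrightarrow> y \<in> S)"
    for S :: "('a, 'b) ptensor set" by (rule open_ptensor_def)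
  show "(norm x = 0) = (x = 0)"
  proof transfer
    fix X :: "nat \<Rightarrow> 'a \<times> 'b \<Rightarrow>\<^sub>0 complex" assume X: "ptensor_rel X X"
    have "ptensor_rel X (\<lambda>_. 0) \<longleftrightarrow> (\<lambda>n. proj_norm (X n)) \<longlonglongrightarrow> 0"
      using X by (simp add: ptensor_rel_def proj_Cauchy_const)
    also have "\<dots> \<longleftrightarrow> lim (\<lambda>n. proj_norm (X n)) = 0"
      using nrm[OF X] by (metis limI)
    finally show "(lim (\<lambda>n. proj_norm (X n)) = 0) = ptensor_rel X (\<lambda>_. 0)" by simp
  qed
  show "norm (x + y) \<le> norm x + norm y"
  proof transfer
    fix X Y :: "nat \<Rightarrow> 'a \<times> 'b \<Rightarrow>\<^sub>0 complex"
    assume X: "ptensor_rel X X" and Y: "ptensor_rel Y Y"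
    show "lim (\<lambda>n. proj_norm (X n + Y n)) \<le> lim (\<lambda>n. proj_norm (X n)) + lim (\<lambda>n. proj_norm (Y n))"
      by (rule LIMSEQ_le[OF nrm[OF ptensor_rel_add[OF X Y]] tendsto_add[OF nrm[OF X] nrm[OF Y]]])
         (auto intro: proj_norm_add)
  qed
  have sc: "lim (\<lambda>n. proj_norm (formal_scale e (X n))) = cmod e * lim (\<lambda>n. proj_norm (X n))"
    if "ptensor_rel X X" for e and X :: "nat \<Rightarrow> 'a \<times> 'b \<Rightarrow>\<^sub>0 complex"
    unfolding proj_norm_scale by (intro limI tendsto_mult_left nrm that)
  show "norm (a *\<^sub>R x) = \<bar>a\<bar> * norm x"
    by transfer (simp add: sc)
  show "norm (c *\<^sub>C x) = cmod c * norm x"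
    by transfer (simp add: sc)
  show "c *\<^sub>C (x + y) = c *\<^sub>C x + c *\<^sub>C y"
    by transfer (auto intro!: intros simp: refl formal.scale_right_distrib)
  show "(c + d) *\<^sub>C x = c *\<^sub>C x + d *\<^sub>C x"
    by transfer (auto intro!: intros simp: refl formal.scale_left_distrib)
  show "c *\<^sub>C d *\<^sub>C x = (c * d) *\<^sub>C x"
    by transfer (auto intro!: intros simp: refl)
  show "of_real a *\<^sub>C x = a *\<^sub>R x"
    by transfer (auto intro!: intros simp: refl)
qed

end

lift_definition formal_class ::
    "('a :: complex_normed_vector \<times> 'b :: complex_normed_vector \<Rightarrow>\<^sub>0 complex) \<Rightarrow> ('a, 'b) ptensor"
  is "\<lambda>u _. u"
  by (simp add: ptensor_rel_def proj_Cauchy_const)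

definition tens :: "'a :: complex_normed_vector \<Rightarrow> 'b :: complex_normed_vector \<Rightarrow> ('a, 'b) ptensor"
  where "tens a b = formal_class (formal_pair a b)"

lemma norm_formal_class: "norm (formal_class u) = proj_norm u"
  by transfer (rule limI[OF tendsto_const])

lemma formal_class_add: "formal_class (u + v) = formal_class u + formal_class v"
  by transfer (simp add: ptensor_rel_def proj_Cauchy_const)

lemma formal_class_diff: "formal_class (u - v) = formal_class u - formal_class v"
  by transfer (simp add: ptensor_rel_def proj_Cauchy_const)

lemma formal_class_scale: "formal_class (formal_scale c u) = c *\<^sub>C formal_class u"
  by transfer (simp add: ptensor_rel_def proj_Cauchy_const)

lemma formal_class_0: "formal_class 0 = 0"
  by transfer (simp add: ptensor_rel_def proj_Cauchy_const)

lemma formal_class_null: "u \<in> tensor_null \<Longrightarrow> formal_class u = 0"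
  using norm_formal_class[of u] proj_norm_null[of u] by simp

lemma formal_class_LIMSEQ:
  assumes X: "proj_Cauchy X"
  shows "(\<lambda>n. formal_class (X n)) \<longlonglongrightarrow> abs_ptensor X"
proof (rule metric_LIMSEQ_I)
  have R: "ptensor_rel X X" using X by (simp add: ptensor_rel_def)
  fix e :: real assume "e > 0"
  then obtain N where N: "\<And>m n. m \<ge> N \<Longrightarrow> n \<ge> N \<Longrightarrow> proj_norm (X m - X n) < e/2"
    using X unfolding proj_Cauchy_def by (metis half_gt_zero)
  have "dist (formal_class (X n)) (abs_ptensor X) < e" if n: "n \<ge> N" for n
  proof -
    have c: "ptensor_rel (\<lambda>_. X n) (\<lambda>_. X n)" by (simp add: ptensor_rel_def proj_Cauchy_const)
    have "formal_class (X n) - abs_ptensor X = abs_ptensor (\<lambda>m. X n - X m)"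
      unfolding formal_class.abs_eq
      by (rule minus_ptensor.abs_eq) (use c R in \<open>simp_all add: eq_onp_def\<close>)
    moreover have "norm (abs_ptensor (\<lambda>m. X n - X m)) = lim (\<lambda>m. proj_norm (X n - X m))"
      by (rule norm_ptensor.abs_eq) (use ptensor_rel_diff[OF c R] in \<open>simp add: eq_onp_def\<close>)
    moreover have "convergent (\<lambda>m. proj_norm (X n - X m))"
      by (intro proj_Cauchy_norm_convergent proj_Cauchy_diff proj_Cauchy_const X)
    ultimately have "(\<lambda>m. proj_norm (X n - X m)) \<longlonglongrightarrow> norm (formal_class (X n) - abs_ptensor X)"
      by (simp add: convergent_LIMSEQ_iff)
    then have "norm (formal_class (X n) - abs_ptensor X) \<le> e/2"
      by (rule LIMSEQ_le_const2) (use N[OF n] in \<open>auto intro: less_imp_le\<close>)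
    then show ?thesis using \<open>e > 0\<close> by (simp add: dist_norm)
  qed
  then show "\<exists>N. \<forall>n\<ge>N. dist (formal_class (X n)) (abs_ptensor X) < e" by blast
qed

lemma ex_formal_class_LIMSEQ: "\<exists>X. proj_Cauchy X \<and> (\<lambda>n. formal_class (X n)) \<longlonglongrightarrow> t"
proof -
  obtain X where "ptensor_rel X X" "t = abs_ptensor X"
    by (metis Quotient_ptensor Quotient_abs_rep Quotient_rep_reflp)
  then show ?thesis
    using formal_class_LIMSEQ by (auto simp: ptensor_rel_def)
qed

instance ptensor :: (complex_normed_vector, complex_normed_vector) complex_banach
proof
  fix T :: "nat \<Rightarrow> ('a, 'b) ptensor" assume T: "Cauchy T"
  have "\<exists>u. dist (formal_class u) (T n) < inverse (Suc n)" for n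
  proof -
    obtain X where "(\<lambda>k. formal_class (X k)) \<longlonglongrightarrow> T n" using ex_formal_class_LIMSEQ by blast
    then have "\<forall>\<^sub>F k in sequentially. dist (formal_class (X k)) (T n) < inverse (Suc n)"
      by (rule tendstoD) simp
    then show ?thesis by (auto simp: eventually_sequentially)
  qed
  then obtain Y where Y: "\<And>n. dist (formal_class (Y n)) (T n) < inverse (Suc n)" by metis
  have lim0: "(\<lambda>n. dist (formal_class (Y n)) (T n)) \<longlonglongrightarrow> 0"
    by (rule tendsto_0_le[OF _ _ LIMSEQ_inverse_real_of_nat]) (use Y in \<open>auto intro: less_imp_le\<close>)
  have CY: "Cauchy (\<lambda>n. formal_class (Y n))"
  proof (rule metric_CauchyI)
    fix e :: real assume e: "e > 0"
    obtain M where M: "\<And>m n. m \<ge> M \<Longrightarrow> n \<ge> M \<Longrightarrow> dist (T m) (T n) < e/3"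
      using metric_CauchyD[OF T, of "e/3"] e by auto
    have "\<forall>\<^sub>F n in sequentially. dist (formal_class (Y n)) (T n) < e/3"
      by (rule order_tendstoD(2)[OF lim0]) (use e in simp)
    then obtain N where N: "\<And>n. n \<ge> N \<Longrightarrow> dist (formal_class (Y n)) (T n) < e/3"
      by (auto simp: eventually_sequentially)
    have "dist (formal_class (Y m)) (formal_class (Y n)) < e" if "m \<ge> max M N" "n \<ge> max M N" for m n
      using dist_triangle[of "formal_class (Y m)" "formal_class (Y n)" "T m"]
        dist_triangle2[of "T m" "formal_class (Y n)" "T n"] M[of m n] N[of m] N[of n] that
      by simp
    then show "\<exists>N. \<forall>m\<ge>N. \<forall>n\<ge>N. dist (formal_class (Y m)) (formal_class (Y n)) < e" by blast
  qed
  have "proj_Cauchy Y"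
    using CY unfolding Cauchy_def proj_Cauchy_def dist_norm
    by (simp add: norm_formal_class flip: formal_class_diff)
  from formal_class_LIMSEQ[OF this]
  have "(\<lambda>n. T n) \<longlonglongrightarrow> abs_ptensor Y"
  proof (rule Lim_transform)
    show "(\<lambda>n. T n - formal_class (Y n)) \<longlonglongrightarrow> 0"
      using lim0 by (subst (asm) dist_commute) (simp add: dist_norm tendsto_norm_zero_iff)
  qed
  then show "convergent T" by (auto simp: convergent_def)
qed

text \<open>The linear extension of a map on pairs, and the universal property of the tensor product.\<close>

definition formal_ext ::
    "('a \<Rightarrow> 'b \<Rightarrow> 'c :: complex_normed_vector) \<Rightarrow> ('a \<times> 'b \<Rightarrow>\<^sub>0 complex) \<Rightarrow> 'c"
  where "formal_ext f u =
    (\<Sum>k\<in>Poly_Mapping.keys u. Poly_Mapping.lookup u k *\<^sub>C f (fst k) (snd k))"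

lemma formal_ext_superset:
  "finite S \<Longrightarrow> Poly_Mapping.keys u \<subseteq> S \<Longrightarrow>
    formal_ext f u = (\<Sum>k\<in>S. Poly_Mapping.lookup u k *\<^sub>C f (fst k) (snd k))"
  unfolding formal_ext_def by (intro sum.mono_neutral_left) (auto simp: in_keys_iff)

lemma formal_ext_add: "formal_ext f (u + v) = formal_ext f u + formal_ext f v"
proof -
  define S where "S = Poly_Mapping.keys u \<union> Poly_Mapping.keys v"
  have S: "finite S" "Poly_Mapping.keys u \<subseteq> S" "Poly_Mapping.keys v \<subseteq> S"
    "Poly_Mapping.keys (u + v) \<subseteq> S"
    unfolding S_def using Poly_Mapping.keys_add[of u v] by auto
  show ?thesis
    by (simp add: formal_ext_superset[OF S(1)] S lookup_add scaleC_add_left sum.distrib)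
qed

lemma formal_ext_scale: "formal_ext f (formal_scale c u) = c *\<^sub>C formal_ext f u"
proof -
  have "Poly_Mapping.keys (formal_scale c u) \<subseteq> Poly_Mapping.keys u"
    by (auto simp: in_keys_iff)
  from formal_ext_superset[OF finite_keys this] show ?thesis
    by (simp add: formal_ext_def scaleC_sum_right scaleC_scaleC)
qed

lemma formal_ext_uminus: "formal_ext f (- u) = - formal_ext f u"
  using formal_ext_scale[of f "-1" u] by (simp add: scaleC_minus_one)

lemma formal_ext_diff: "formal_ext f (u - v) = formal_ext f u - formal_ext f v"
  using formal_ext_add[of f u "- v"] by (simp add: formal_ext_uminus)

lemma formal_ext_pair: "formal_ext f (formal_pair a b) = f a b"
  unfolding formal_ext_def by simp

lemma formal_ext_sum_list:
  "formal_ext f (\<Sum>(a, b)\<leftarrow>xs. formal_pair a b) = (\<Sum>(a, b)\<leftarrow>xs. f a b)"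
proof (induction xs)
  case Nil
  then show ?case by (simp add: formal_ext_def)
next
  case (Cons x xs)
  then show ?case by (cases x) (simp add: formal_ext_add formal_ext_pair)
qed

lemma formal_ext_null:
  assumes f: "bounded_cbilinear f" and u: "u \<in> tensor_null"
  shows "formal_ext f u = 0"
proof -
  interpret bounded_bilinear f using f by (simp add: bounded_cbilinear_def)
  have sub: "formal.subspace {u. formal_ext f u = 0}"
    by (rule formal.subspaceI) (auto simp: formal_ext_add formal_ext_scale, simp add: formal_ext_def)
  have "tensor_null \<subseteq> {u. formal_ext f u = 0}"
    unfolding tensor_null_def using f
    by (intro formal.span_minimal[OF _ sub])
       (auto simp: formal_ext_diff formal_ext_pair formal_ext_scale add_left add_right
          bounded_cbilinear_def)
  with u show ?thesis by blast
qed

lemma formal_ext_bound: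
  assumes f: "bounded_cbilinear f" and K: "\<And>a b. norm (f a b) \<le> norm a * norm b * K" "K \<ge> 0"
  shows "norm (formal_ext f u) \<le> proj_norm u * K"
proof (rule field_le_epsilon)
  fix e :: real assume e: "0 < e"
  define d where "d = e / (K + 1)"
  have d: "d > 0" "d * K \<le> e"
    using e K(2) by (auto simp: d_def field_simps)
  obtain xs where xs: "u - (\<Sum>(a, b)\<leftarrow>xs. formal_pair a b) \<in> tensor_null"
    "(\<Sum>(a, b)\<leftarrow>xs. norm a * norm b) < proj_norm u + d"
    using proj_norm_approx[of u "proj_norm u + d"] d by auto
  have "formal_ext f u = (\<Sum>(a, b)\<leftarrow>xs. f a b)"
    using formal_ext_null[OF f xs(1)] by (simp add: formal_ext_diff formal_ext_sum_list)
  moreover have "norm (\<Sum>(a, b)\<leftarrow>ys. f a b) \<le> (\<Sum>(a, b)\<leftarrow>ys. norm a * norm b) * K" for ys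
  proof (induction ys)
    case Nil
    then show ?case by simp
  next
    case (Cons y ys)
    obtain a b where y: "y = (a, b)" by fastforce
    show ?case
      using Cons.IH K(1)[of a b] norm_triangle_ineq[of "f a b" "\<Sum>(a, b)\<leftarrow>ys. f a b"]
      unfolding y by (simp add: distrib_right)
  qed
  ultimately have "norm (formal_ext f u) \<le> (\<Sum>(a, b)\<leftarrow>xs. norm a * norm b) * K" by simp
  also have "\<dots> \<le> (proj_norm u + d) * K"
    using xs(2) K(2) by (intro mult_right_mono) auto
  also have "\<dots> \<le> proj_norm u * K + e"
    using d by (simp add: algebra_simps)
  finally show "norm (formal_ext f u) \<le> proj_norm u * K + e" .
qed

lemma bounded_cbilinear_tens: "bounded_cbilinear tens"
proof -
  have eq: "formal_class u = formal_class v" if "u - v \<in> tensor_null"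
    for u v :: "'a \<times> 'b \<Rightarrow>\<^sub>0 complex"
    using formal_class_null[OF that] by (simp add: formal_class_diff)
  have 1: "tens (a + a') b = tens a b + tens a' b" and 2: "tens a (b + b') = tens a b + tens a b'"
    for a a' :: 'a and b b' :: 'b
    unfolding tens_def formal_class_add[symmetric]
    using tensor_null_rels by (auto intro!: eq simp: diff_diff_eq)
  have 3: "tens (c *\<^sub>C a) b = c *\<^sub>C tens a b" and 4: "tens a (c *\<^sub>C b) = c *\<^sub>C tens a b"
    for a :: 'a and b :: 'b and c
    unfolding tens_def formal_class_scale[symmetric]
    using tensor_null_rels by (auto intro!: eq)
  have "norm (tens a b) \<le> norm a * norm b * 1" for a :: 'a and b :: 'b
    unfolding tens_def norm_formal_class using proj_norm_pair_le by simp
  then have "\<exists>K. \<forall>(a :: 'a) (b :: 'b). norm (tens a b) \<le> norm a * norm b * K" by blast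
  with 1 2 3 4 show ?thesis
    unfolding bounded_cbilinear_def
    by (auto intro!: bounded_bilinear.intro simp flip: scaleC_of_real)
qed

lemma formal_class_eq_formal_ext: "formal_class u = formal_ext tens u"
proof -
  obtain xs where "u - (\<Sum>(a, b)\<leftarrow>xs. formal_pair a b) \<in> tensor_null"
    using formal_repr by blast
  from formal_class_null[OF this] formal_ext_null[OF bounded_cbilinear_tens this]
  have "formal_class u = formal_class (\<Sum>(a, b)\<leftarrow>xs. formal_pair a b)"
    and "formal_ext tens u = (\<Sum>(a, b)\<leftarrow>xs. tens a b)"
    by (simp_all add: formal_class_diff formal_ext_diff formal_ext_sum_list)
  moreover have "formal_class (\<Sum>(a, b)\<leftarrow>xs. formal_pair a b) = (\<Sum>(a, b)\<leftarrow>xs. tens a b)"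
    by (induction xs) (auto simp: formal_class_add formal_class_0 tens_def)
  ultimately show ?thesis by simp
qed

lemma ptensor_ext:
  fixes g h :: "('a :: complex_normed_vector, 'b :: complex_normed_vector) ptensor \<Rightarrow>
    'c :: complex_normed_vector"
  assumes g: "bounded_clinear g" and h: "bounded_clinear h"
    and eq: "\<And>a b. g (tens a b) = h (tens a b)"
  shows "g = h"
proof
  fix t :: "('a, 'b) ptensor"
  interpret g: bounded_linear g using g by (simp add: bounded_clinear_def)
  interpret h: bounded_linear h using h by (simp add: bounded_clinear_def)
  obtain X where X: "(\<lambda>n. formal_class (X n)) \<longlonglongrightarrow> t" using ex_formal_class_LIMSEQ by blast
  have "g (formal_class u) = h (formal_class u)" for u
    using g h unfolding formal_class_eq_formal_ext formal_ext_def g.sum h.sum bounded_clinear_def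
    by (simp add: eq)
  then have "(\<lambda>n. g (formal_class (X n))) = (\<lambda>n. h (formal_class (X n)))" by simp
  with g.tendsto[OF X] h.tendsto[OF X] show "g t = h t" by (metis LIMSEQ_unique)
qed

lemma ptensor_lift_exists:
  fixes f :: "'a :: complex_normed_vector \<Rightarrow> 'b :: complex_normed_vector \<Rightarrow> 'c :: complex_banach"
  assumes f: "bounded_cbilinear f" and K: "\<And>a b. norm (f a b) \<le> norm a * norm b * K" "K \<ge> 0"
  shows "\<exists>g. bounded_clinear g \<and> (\<forall>a b. g (tens a b) = f a b) \<and> (\<forall>t. norm (g t) \<le> norm t * K)"
proof -
  have dist_le: "norm (formal_ext f u - formal_ext f v) \<le> norm (formal_class u - formal_class v) * K"
    for u v
    using formal_ext_bound[OF f K, of "u - v"]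
    by (simp add: formal_ext_diff norm_formal_class flip: formal_class_diff)
  have "\<exists>y. \<forall>X. (\<lambda>n. formal_class (X n)) \<longlonglongrightarrow> t \<longrightarrow> (\<lambda>n. formal_ext f (X n)) \<longlonglongrightarrow> y" for t
  proof -
    obtain X where X: "(\<lambda>n. formal_class (X n)) \<longlonglongrightarrow> t" using ex_formal_class_LIMSEQ by blast
    have "Cauchy (\<lambda>n. formal_ext f (X n))"
    proof (rule metric_CauchyI)
      fix e :: real assume e: "e > 0"
      have "e / (K + 1) > 0" using e K(2) by simp
      then obtain N where N: "\<And>m n. m \<ge> N \<Longrightarrow> n \<ge> N \<Longrightarrow>
          dist (formal_class (X m)) (formal_class (X n)) < e / (K + 1)"
        using metric_CauchyD[OF LIMSEQ_imp_Cauchy[OF X]] by blast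
      have "dist (formal_ext f (X m)) (formal_ext f (X n)) < e" if "m \<ge> N" "n \<ge> N" for m n
      proof -
        have "dist (formal_ext f (X m)) (formal_ext f (X n)) \<le> e / (K + 1) * K"
          unfolding dist_norm
          by (rule order_trans[OF dist_le mult_right_mono])
             (use N[OF that] K(2) in \<open>auto simp: dist_norm\<close>)
        also have "\<dots> < e" using e K(2) by (simp add: field_simps)
        finally show ?thesis .
      qed
      then show "\<exists>N. \<forall>m\<ge>N. \<forall>n\<ge>N. dist (formal_ext f (X m)) (formal_ext f (X n)) < e" by blast
    qed
    then obtain y where y: "(\<lambda>n. formal_ext f (X n)) \<longlonglongrightarrow> y"
      using Cauchy_convergent convergent_def by blast
    have "(\<lambda>n. formal_ext f (Y n)) \<longlonglongrightarrow> y" if Y: "(\<lambda>n. formal_class (Y n)) \<longlonglongrightarrow> t" for Y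
    proof (rule Lim_transform[OF y])
      have "(\<lambda>n. norm (formal_class (Y n) - formal_class (X n)) * K) \<longlonglongrightarrow> norm (t - t) * K"
        by (intro tendsto_intros X Y)
      then have "(\<lambda>n. norm (formal_ext f (Y n) - formal_ext f (X n))) \<longlonglongrightarrow> 0"
        by (intro tendsto_0_le[OF norm_ge_zero dist_le]) simp
      then show "(\<lambda>n. formal_ext f (Y n) - formal_ext f (X n)) \<longlonglongrightarrow> 0"
        by (rule tendsto_norm_zero_cancel)
    qed
    then show ?thesis by blast
  qed
  then obtain g where g: "\<And>t X. (\<lambda>n. formal_class (X n)) \<longlonglongrightarrow> t \<Longrightarrow> (\<lambda>n. formal_ext f (X n)) \<longlonglongrightarrow> g t"
    by metis
  have "bounded_clinear g \<and> (\<forall>t. norm (g t) \<le> norm t * K)"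
  proof (intro conjI allI bounded_clinearI[where K = K])
    fix s t :: "('a, 'b) ptensor" and c
    obtain X where X: "(\<lambda>n. formal_class (X n)) \<longlonglongrightarrow> s" using ex_formal_class_LIMSEQ by blast
    obtain Y where Y: "(\<lambda>n. formal_class (Y n)) \<longlonglongrightarrow> t" using ex_formal_class_LIMSEQ by blast
    have "(\<lambda>n. formal_class (X n + Y n)) \<longlonglongrightarrow> s + t"
      unfolding formal_class_add by (intro tendsto_add X Y)
    from g[OF this] tendsto_add[OF g[OF X] g[OF Y]] show "g (s + t) = g s + g t"
      unfolding formal_ext_add by (rule LIMSEQ_unique)
    have "(\<lambda>n. formal_class (formal_scale c (X n))) \<longlonglongrightarrow> c *\<^sub>C s"
      unfolding formal_class_scale by (rule bounded_linear.tendsto[OF bounded_linear_scaleC_right X])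
    from g[OF this] bounded_linear.tendsto[OF bounded_linear_scaleC_right g[OF X], of c]
    show "g (c *\<^sub>C s) = c *\<^sub>C g s"
      unfolding formal_ext_scale by (rule LIMSEQ_unique)
    show le: "norm (g s) \<le> norm s * K"
      by (rule LIMSEQ_le[OF tendsto_norm[OF g[OF X]] tendsto_mult_right[OF tendsto_norm[OF X]]])
         (auto simp: norm_formal_class intro!: formal_ext_bound[OF f K])
    then show "norm (g s) \<le> norm s * K" .
  qed
  moreover have "g (tens a b) = f a b" for a b
  proof -
    have "(\<lambda>n. formal_ext f (formal_pair a b)) \<longlonglongrightarrow> g (tens a b)"
      by (rule g) (simp add: tens_def)
    then show ?thesis by (simp add: formal_ext_pair LIMSEQ_const_iff)
  qed
  ultimately show ?thesis by blast
qed

definition ptensor_lift ::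
    "('a :: complex_normed_vector \<Rightarrow> 'b :: complex_normed_vector \<Rightarrow> 'c :: complex_banach)
     \<Rightarrow> ('a, 'b) ptensor \<Rightarrow> 'c"
  where "ptensor_lift f = (THE g. bounded_clinear g \<and> (\<forall>a b. g (tens a b) = f a b))"

lemma bounded_cbilinear_bound:
  assumes "bounded_cbilinear f"
  obtains K where "K \<ge> 0" "\<And>a b. norm (f a b) \<le> norm a * norm b * K"
  using bounded_bilinear.nonneg_bounded[of f] assms unfolding bounded_cbilinear_def by blast

lemma ptensor_lift:
  assumes "bounded_cbilinear f"
  shows "bounded_clinear (ptensor_lift f)" "ptensor_lift f (tens a b) = f a b"
proof -
  obtain K where K: "K \<ge> 0" "\<And>a b. norm (f a b) \<le> norm a * norm b * K"
    using bounded_cbilinear_bound[OF assms] by blast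
  obtain g where g: "bounded_clinear g \<and> (\<forall>a b. g (tens a b) = f a b)"
    using ptensor_lift_exists[OF assms K(2,1)] by blast
  have "bounded_clinear (ptensor_lift f) \<and> (\<forall>a b. ptensor_lift f (tens a b) = f a b)"
    unfolding ptensor_lift_def
    by (rule theI[of _ g]) (use g in \<open>auto intro!: ptensor_ext\<close>)
  then show "bounded_clinear (ptensor_lift f)" "ptensor_lift f (tens a b) = f a b" by auto
qed

lemma ptensor_lift_unique:
  assumes "bounded_cbilinear f" "bounded_clinear g" "\<And>a b. g (tens a b) = f a b"
  shows "g = ptensor_lift f"
  using assms by (auto intro!: ptensor_ext simp: ptensor_lift)

lemma norm_ptensor_lift_le:
  assumes f: "bounded_cbilinear f" and K: "\<And>a b. norm (f a b) \<le> norm a * norm b * K" "K \<ge> 0"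
  shows "norm (ptensor_lift f t) \<le> norm t * K"
proof -
  obtain g where g: "bounded_clinear g" "\<And>a b. g (tens a b) = f a b" "\<And>t. norm (g t) \<le> norm t * K"
    using ptensor_lift_exists[OF f K] by blast
  then show ?thesis using ptensor_lift_unique[OF f g(1,2)] by simp
qed

section \<open>Banach bimodules\<close>

text \<open>In a bimodule \<open>M\<close>, \<open>lact M a x\<close> is \<open>a \<cdot> x\<close> and \<open>ract M a x\<close> is \<open>x \<cdot> a\<close>.\<close>

record ('a, 'e) bimodule =
  lact :: "'a \<Rightarrow> 'e \<Rightarrow> 'e"
  ract :: "'a \<Rightarrow> 'e \<Rightarrow> 'e"

definition banach_bimodule ::
    "('a :: complex_banach_algebra, 'e :: complex_banach) bimodule \<Rightarrow> bool"
  where "banach_bimodule M \<longleftrightarrow> bounded_cbilinear (lact M) \<and> bounded_cbilinear (ract M) \<and>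
    (\<forall>a b x. lact M (a * b) x = lact M a (lact M b x) \<and>
             ract M (a * b) x = ract M b (ract M a x) \<and>
             ract M b (lact M a x) = lact M a (ract M b x))"

definition self_bimodule :: "('a :: complex_banach_algebra, 'a) bimodule"
  where "self_bimodule = \<lparr>lact = (\<lambda>a x. a * x), ract = (\<lambda>a x. x * a)\<rparr>"

definition ptensor_bimodule :: "('a :: complex_banach_algebra, ('a, 'a) ptensor) bimodule"
  where "ptensor_bimodule =
    \<lparr>lact = (\<lambda>a. ptensor_lift (\<lambda>b c. tens (a * b) c)),
     ract = (\<lambda>a. ptensor_lift (\<lambda>b c. tens b (c * a)))\<rparr>"

text \<open>\<open>(a \<cdot> \<phi>)(x) = \<phi>(x \<cdot> a)\<close> and \<open>(\<phi> \<cdot> a)(x) = \<phi>(a \<cdot> x)\<close>.\<close>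

definition dual_bimodule ::
    "('a, 'e :: complex_normed_vector) bimodule \<Rightarrow> ('a, 'e cdual) bimodule"
  where "dual_bimodule M =
    \<lparr>lact = (\<lambda>a. cadjoint (ract M a)), ract = (\<lambda>a. cadjoint (lact M a))\<rparr>"

lemma bounded_cbilinearI:
  fixes f :: "'a :: complex_normed_vector \<Rightarrow> 'b :: complex_normed_vector
    \<Rightarrow> 'c :: complex_normed_vector"
  assumes "\<And>x x' y. f (x + x') y = f x y + f x' y" "\<And>x y y'. f x (y + y') = f x y + f x y'"
    and "\<And>c x y. f (c *\<^sub>C x) y = c *\<^sub>C f x y" "\<And>c x y. f x (c *\<^sub>C y) = c *\<^sub>C f x y"
    and "\<And>x y. norm (f x y) \<le> norm x * norm y * K"
  shows "bounded_cbilinear f"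
  unfolding bounded_cbilinear_def
  using assms by (auto intro!: bounded_bilinear.intro exI[of _ K] simp flip: scaleC_of_real)

lemma bounded_cbilinearD:
  assumes "bounded_cbilinear f"
  shows "f (x + x') y = f x y + f x' y" "f x (y + y') = f x y + f x y'"
    "f (c *\<^sub>C x) y = c *\<^sub>C f x y" "f x (c *\<^sub>C y) = c *\<^sub>C f x y"
    "bounded_clinear (f x)" "bounded_clinear (\<lambda>x. f x y)"
proof -
  interpret bounded_bilinear f using assms by (simp add: bounded_cbilinear_def)
  show "f (x + x') y = f x y + f x' y" "f x (y + y') = f x y + f x y'"
    by (rule add_left, rule add_right)
  show "f (c *\<^sub>C x) y = c *\<^sub>C f x y" "f x (c *\<^sub>C y) = c *\<^sub>C f x y"
    "bounded_clinear (f x)" "bounded_clinear (\<lambda>x. f x y)"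
    using assms bounded_linear_left bounded_linear_right
    unfolding bounded_cbilinear_def bounded_clinear_def by auto
qed

lemma norm_tens_le: "norm (tens a b) \<le> norm a * norm b"
  unfolding tens_def norm_formal_class by (rule proj_norm_pair_le)

lemma norm_cdual_bound:
  assumes "\<And>x. cmod (capply f x) \<le> norm x * K" "K \<ge> 0"
  shows "norm f \<le> K"
  using assms by transfer (auto intro!: norm_blinfun_bound simp: mult.commute)

lemma bounded_cbilinear_mult:
  "bounded_cbilinear (\<lambda>a b :: 'a :: complex_banach_algebra. a * b)"
  by (rule bounded_cbilinearI[where K = 1])
     (auto simp: algebra_simps scaleC_mult_left scaleC_mult_right norm_mult_ineq)

lemma bounded_cbilinear_mult_flip:
  "bounded_cbilinear (\<lambda>a x :: 'a :: complex_banach_algebra. x * a)"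
proof (rule bounded_cbilinearI[where K = 1])
  show "norm (x * a) \<le> norm a * norm x * 1" for a x :: 'a
    using norm_mult_ineq[of x a] by (simp only: mult.commute[of "norm x" "norm a"] mult_1_right)
qed (auto simp: distrib_left distrib_right scaleC_mult_left scaleC_mult_right)

lemma banach_bimodule_self: "banach_bimodule self_bimodule"
  unfolding banach_bimodule_def self_bimodule_def
  by (simp add: bounded_cbilinear_mult bounded_cbilinear_mult_flip mult.assoc)

lemma norm_tens_actions_le:
  fixes a b c :: "'a :: complex_banach_algebra"
  shows "norm (tens (a * b) c) \<le> norm b * norm c * norm a"
    "norm (tens b (c * a)) \<le> norm b * norm c * norm a"
proof -
  show "norm (tens (a * b) c) \<le> norm b * norm c * norm a"
    using order_trans[OF norm_tens_le mult_right_mono[OF norm_mult_ineq norm_ge_zero], of a b c]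
    by (simp add: mult_ac)
  show "norm (tens b (c * a)) \<le> norm b * norm c * norm a"
    using order_trans[OF norm_tens_le mult_left_mono[OF norm_mult_ineq norm_ge_zero], of b c a]
    by (simp add: mult_ac)
qed

lemma bounded_cbilinear_tens_actions:
  fixes a :: "'a :: complex_banach_algebra"
  shows "bounded_cbilinear (\<lambda>b (c :: 'a). tens (a * b) c)"
    "bounded_cbilinear (\<lambda>(b :: 'a) c. tens b (c * a))"
proof -
  note t = bounded_cbilinearD(1-4)[OF bounded_cbilinear_tens]
  show "bounded_cbilinear (\<lambda>b (c :: 'a). tens (a * b) c)"
    by (rule bounded_cbilinearI[where K = "norm a"])
       (auto simp: distrib_left scaleC_mult_right t norm_tens_actions_le)
  show "bounded_cbilinear (\<lambda>(b :: 'a) c. tens b (c * a))"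
    by (rule bounded_cbilinearI[where K = "norm a"])
       (auto simp: distrib_right scaleC_mult_left t norm_tens_actions_le)
qed

lemma ptensor_bimodule_tens:
  "lact ptensor_bimodule a (tens b c) = tens (a * b) c"
  "ract ptensor_bimodule a (tens b c) = tens b (c * a)"
  unfolding ptensor_bimodule_def
  by (simp_all add: ptensor_lift bounded_cbilinear_tens_actions)

lemma ptensor_bimodule_clinear:
  "bounded_clinear (lact ptensor_bimodule a)" "bounded_clinear (ract ptensor_bimodule a)"
  unfolding ptensor_bimodule_def
  by (simp_all add: ptensor_lift bounded_cbilinear_tens_actions)

lemma bounded_clinear_add:
  "bounded_clinear f \<Longrightarrow> bounded_clinear g \<Longrightarrow> bounded_clinear (\<lambda>x. f x + g x)"
  unfolding bounded_clinear_def by (auto intro: bounded_linear_add simp: scaleC_add_right)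

lemma bounded_clinear_scale: "bounded_clinear f \<Longrightarrow> bounded_clinear (\<lambda>x. c *\<^sub>C f x)"
  unfolding bounded_clinear_def
  by (auto intro: bounded_linear_compose[OF bounded_linear_scaleC_right]
      simp: scaleC_scaleC mult.commute)

lemma bounded_clinearD:
  assumes "bounded_clinear f"
  shows "f (x + y) = f x + f y" "f (c *\<^sub>C x) = c *\<^sub>C f x"
  using assms unfolding bounded_clinear_def by (auto simp: linear_add bounded_linear.linear)

lemma banach_bimodule_ptensor:
  "banach_bimodule (ptensor_bimodule :: ('a :: complex_banach_algebra, ('a, 'a) ptensor) bimodule)"
proof -
  let ?M = "ptensor_bimodule :: ('a, ('a, 'a) ptensor) bimodule"
  note t = bounded_cbilinearD(1-4)[OF bounded_cbilinear_tens]
  note intros = bounded_clinear_add bounded_clinear_scale ptensor_bimodule_clinear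
  note T = ptensor_bimodule_tens t distrib_left distrib_right scaleC_mult_left scaleC_mult_right
  have ext: "g t = h t" if "bounded_clinear g" "bounded_clinear h" "\<And>a b. g (tens a b) = h (tens a b)"
    for g h :: "('a, 'a) ptensor \<Rightarrow> ('a, 'a) ptensor" and t
    using ptensor_ext[of g h] that by metis
  have "bounded_cbilinear (lact ?M)"
  proof (rule bounded_cbilinearI[where K = 1])
    show "norm (lact ?M a x) \<le> norm a * norm x * 1" for a x
      unfolding ptensor_bimodule_def bimodule.simps
      using norm_ptensor_lift_le[OF bounded_cbilinear_tens_actions(1) norm_tens_actions_le(1)
          norm_ge_zero, of a x]
      by (simp add: mult.commute[of "norm x"])
    show "lact ?M (a + b) x = lact ?M a x + lact ?M b x" for a b x
      by (rule ext[of "lact ?M (a + b)" "\<lambda>x. lact ?M a x + lact ?M b x"])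
         (auto intro!: intros simp: T)
    show "lact ?M (c *\<^sub>C a) x = c *\<^sub>C lact ?M a x" for a c x
      by (rule ext[of "lact ?M (c *\<^sub>C a)" "\<lambda>x. c *\<^sub>C lact ?M a x"])
         (auto intro!: intros simp: T)
  qed (auto intro: bounded_clinearD ptensor_bimodule_clinear)
  moreover have "bounded_cbilinear (ract ?M)"
  proof (rule bounded_cbilinearI[where K = 1])
    show "norm (ract ?M a x) \<le> norm a * norm x * 1" for a x
      unfolding ptensor_bimodule_def bimodule.simps
      using norm_ptensor_lift_le[OF bounded_cbilinear_tens_actions(2) norm_tens_actions_le(2)
          norm_ge_zero, of a x]
      by (simp add: mult.commute[of "norm x"])
    show "ract ?M (a + b) x = ract ?M a x + ract ?M b x" for a b x
      by (rule ext[of "ract ?M (a + b)" "\<lambda>x. ract ?M a x + ract ?M b x"])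
         (auto intro!: intros simp: T)
    show "ract ?M (c *\<^sub>C a) x = c *\<^sub>C ract ?M a x" for a c x
      by (rule ext[of "ract ?M (c *\<^sub>C a)" "\<lambda>x. c *\<^sub>C ract ?M a x"])
         (auto intro!: intros simp: T)
  qed (auto intro: bounded_clinearD ptensor_bimodule_clinear)
  moreover have "lact ?M (a * b) x = lact ?M a (lact ?M b x)" for a b x
    by (rule ext[of "lact ?M (a * b)" "\<lambda>x. lact ?M a (lact ?M b x)"])
       (auto intro!: ptensor_bimodule_clinear bounded_clinear_compose[of "lact ?M a"] simp: T mult.assoc)
  moreover have "ract ?M (a * b) x = ract ?M b (ract ?M a x)" for a b x
    by (rule ext[of "ract ?M (a * b)" "\<lambda>x. ract ?M b (ract ?M a x)"])
       (auto intro!: ptensor_bimodule_clinear bounded_clinear_compose[of "ract ?M b"] simp: T mult.assoc)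
  moreover have "ract ?M b (lact ?M a x) = lact ?M a (ract ?M b x)" for a b x
    by (rule ext[of "\<lambda>x. ract ?M b (lact ?M a x)" "\<lambda>x. lact ?M a (ract ?M b x)"])
       (auto intro!: ptensor_bimodule_clinear bounded_clinear_compose[of "lact ?M a"]
          bounded_clinear_compose[of "ract ?M b"] simp: T)
  ultimately show ?thesis unfolding banach_bimodule_def by blast
qed

lemma bounded_cbilinear_cadjoint:
  assumes f: "bounded_cbilinear f"
  shows "bounded_cbilinear (\<lambda>a. cadjoint (f a))"
proof -
  obtain K where K: "K \<ge> 0" "\<And>a b. norm (f a b) \<le> norm a * norm b * K"
    using bounded_cbilinear_bound[OF f] by blast
  note ap = capply_cadjoint[OF bounded_cbilinearD(5)[OF f]]
  note D = bounded_cbilinearD[OF f] bounded_clinearD[OF bounded_clinear_capply]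
  have "norm (cadjoint (f a) \<phi>) \<le> norm a * norm \<phi> * K" for a \<phi>
  proof (rule norm_cdual_bound)
    fix x
    have "cmod (capply \<phi> (f a x)) \<le> norm \<phi> * (norm a * norm x * K)"
      by (rule order_trans[OF norm_capply mult_left_mono[OF K(2)]]) simp
    then show "cmod (capply (cadjoint (f a) \<phi>) x) \<le> norm x * (norm a * norm \<phi> * K)"
      by (simp add: ap mult_ac)
  qed (use K(1) in simp)
  then show ?thesis
    by (intro bounded_cbilinearI[where K = K])
       (auto intro!: cdual_eqI simp: ap D(1-4) D(7,8) scaleC_complex_def)
qed

lemma banach_bimodule_dual:
  assumes M: "banach_bimodule M"
  shows "banach_bimodule (dual_bimodule M)"
proof -
  have B: "bounded_cbilinear (lact M)" "bounded_cbilinear (ract M)"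
    using M by (auto simp: banach_bimodule_def)
  note ap = capply_cadjoint[OF bounded_cbilinearD(5)[OF B(1)]]
    capply_cadjoint[OF bounded_cbilinearD(5)[OF B(2)]]
  show ?thesis
    using M bounded_cbilinear_cadjoint[OF B(1)] bounded_cbilinear_cadjoint[OF B(2)]
    unfolding banach_bimodule_def dual_bimodule_def
    by (auto intro!: cdual_eqI simp: ap)
qed

section \<open>Duals of subspaces and weak topologies\<close>

text \<open>The Banach dual of a subspace \<open>S\<close>; its elements are functions on \<open>S\<close>, extended by
  \<^const>\<open>undefined\<close>.\<close>

definition dual_on :: "'e :: complex_normed_vector set \<Rightarrow> ('e \<Rightarrow> complex) set"
  where "dual_on S = {m \<in> extensional S.
    (\<forall>x\<in>S. \<forall>y\<in>S. m (x + y) = m x + m y) \<and> (\<forall>c. \<forall>x\<in>S. m (c *\<^sub>C x) = c * m x) \<and>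
    (\<exists>K. \<forall>x\<in>S. cmod (m x) \<le> K * norm x)}"

text \<open>The dual module actions on the dual of a submodule \<open>S\<close> of \<open>M\<close>.\<close>

definition dual_on_bimodule :: "('a, 'e) bimodule \<Rightarrow> 'e set \<Rightarrow> ('a, 'e \<Rightarrow> complex) bimodule"
  where "dual_on_bimodule M S =
    \<lparr>lact = (\<lambda>a m. \<lambda>x\<in>S. m (ract M a x)), ract = (\<lambda>a m. \<lambda>x\<in>S. m (lact M a x))\<rparr>"

text \<open>The coarsest topology on \<open>X\<close> making all functions \<open>ev i\<close>, \<open>i \<in> I\<close>, continuous.\<close>

definition initial_topology :: "'x set \<Rightarrow> 'i set \<Rightarrow> ('i \<Rightarrow> 'x \<Rightarrow> complex) \<Rightarrow> 'x topology"
  where "initial_topology X I ev =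
    pullback_topology X (\<lambda>x. \<lambda>i\<in>I. ev i x) (product_topology (\<lambda>_. euclidean) I)"

abbreviation weak_topology :: "'e :: complex_normed_vector topology"
  where "weak_topology \<equiv> initial_topology UNIV UNIV capply"

abbreviation weak_star_on :: "'e :: complex_normed_vector set \<Rightarrow> ('e \<Rightarrow> complex) topology"
  where "weak_star_on S \<equiv> initial_topology (dual_on S) S (\<lambda>x m. m x)"

section \<open>Dual Banach algebras\<close>

text \<open>The canonical map from an algebra to the dual of a subspace \<open>P\<close> of its dual.\<close>

definition predual_map :: "'a :: complex_normed_vector cdual set \<Rightarrow> 'a \<Rightarrow> 'a cdual \<Rightarrow> complex"
  where "predual_map P a = (\<lambda>\<phi>\<in>P. capply \<phi> a)"

text \<open>\<open>P\<close> is the predual.  The canonical map is always linear and contractive and \<open>dual_on P\<close> is a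
  Banach space, so bijectivity makes it an isomorphism of Banach spaces; it is not required to be
  isometric.\<close>

definition dual_banach_algebra :: "'a :: complex_banach_algebra cdual set \<Rightarrow> bool"
  where "dual_banach_algebra P \<longleftrightarrow> closed P \<and> csubspace P \<and>
    (\<forall>a. \<forall>\<phi>\<in>P. lact (dual_bimodule self_bimodule) a \<phi> \<in> P \<and>
               ract (dual_bimodule self_bimodule) a \<phi> \<in> P) \<and>
    bij_betw (predual_map P) UNIV (dual_on P)"

abbreviation predual_weak_star :: "'a :: complex_normed_vector cdual set \<Rightarrow> 'a topology"
  where "predual_weak_star P \<equiv> initial_topology UNIV P capply"

definition sigma_wc ::
    "'a :: complex_banach_algebra cdual set \<Rightarrow> ('a, 'e :: complex_banach) bimodule \<Rightarrow> 'e set"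
  where "sigma_wc P M = {x.
    continuous_map (predual_weak_star P) weak_topology (\<lambda>a. lact M a x) \<and>
    continuous_map (predual_weak_star P) weak_topology (\<lambda>a. ract M a x)}"

definition ptensor_mult :: "('a :: complex_banach_algebra, 'a) ptensor \<Rightarrow> 'a"
  where "ptensor_mult = ptensor_lift (\<lambda>a b. a * b)"

abbreviation sigma_wc_tensor ::
    "'a :: complex_banach_algebra cdual set \<Rightarrow> ('a, 'a) ptensor cdual set"
  where "sigma_wc_tensor P \<equiv> sigma_wc P (dual_bimodule ptensor_bimodule)"

text \<open>The adjoint of \<open>cadjoint ptensor_mult\<close> restricted to \<open>P\<close>, followed by the identification
  of \<open>dual_on P\<close> with the algebra.\<close>

definition pi_sigma_wc ::
    "'a :: complex_banach_algebra cdual set \<Rightarrow> (('a, 'a) ptensor cdual \<Rightarrow> complex) \<Rightarrow> 'a"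
  where "pi_sigma_wc P m =
    the_inv (predual_map P) (\<lambda>\<phi>\<in>P. m (cadjoint ptensor_mult \<phi>))"

section \<open>Nets\<close>

text \<open>HOL cannot quantify over the type of the index set of a net, so below a net in \<open>'x\<close> is
  represented by the filter on \<open>'x\<close> generated by its tails.  The following facts show that this
  loses nothing: tail filters are proper, and every proper filter, together with a property holding
  eventually, comes from a net all of whose members have that property.\<close>

definition directed_set :: "'i set \<Rightarrow> ('i \<Rightarrow> 'i \<Rightarrow> bool) \<Rightarrow> bool"
  where "directed_set I le \<longleftrightarrow> I \<noteq> {} \<and> (\<forall>i\<in>I. le i i) \<and>
    (\<forall>i\<in>I. \<forall>j\<in>I. \<forall>k\<in>I. le i j \<longrightarrow> le j k \<longrightarrow> le i k) \<and>
    (\<forall>i\<in>I. \<forall>j\<in>I. \<exists>k\<in>I. le i k \<and> le j k)"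

definition tail_filter :: "'i set \<Rightarrow> ('i \<Rightarrow> 'i \<Rightarrow> bool) \<Rightarrow> ('i \<Rightarrow> 'x) \<Rightarrow> 'x filter"
  where "tail_filter I le m = (INF i\<in>I. principal (m ` {j\<in>I. le i j}))"

lemma eventually_tail_filter:
  assumes "directed_set I le"
  shows "eventually Q (tail_filter I le m) \<longleftrightarrow> (\<exists>i\<in>I. \<forall>j\<in>I. le i j \<longrightarrow> Q (m j))"
proof -
  have ne: "I \<noteq> {}" and refl: "\<And>i. i \<in> I \<Longrightarrow> le i i"
    and trans: "\<And>i j k. i \<in> I \<Longrightarrow> j \<in> I \<Longrightarrow> k \<in> I \<Longrightarrow> le i j \<Longrightarrow> le j k \<Longrightarrow> le i k"
    and ub: "\<And>i j. i \<in> I \<Longrightarrow> j \<in> I \<Longrightarrow> \<exists>k\<in>I. le i k \<and> le j k"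
    using assms unfolding directed_set_def by metis+
  have "eventually Q (tail_filter I le m) \<longleftrightarrow>
      (\<exists>i\<in>I. eventually Q (principal (m ` {j\<in>I. le i j})))"
    unfolding tail_filter_def
  proof (rule eventually_INF_base[OF ne])
    fix i j assume ij: "i \<in> I" "j \<in> I"
    then obtain k where k: "k \<in> I" "le i k" "le j k" using ub by blast
    have "le i l \<and> le j l" if "l \<in> I" "le k l" for l
      using trans[of i k l] trans[of j k l] ij k that by simp
    then have "m ` {l\<in>I. le k l} \<subseteq> m ` {l\<in>I. le i l} \<inter> m ` {l\<in>I. le j l}" by blast
    with k(1) show "\<exists>k\<in>I. principal (m ` {l\<in>I. le k l})
        \<le> inf (principal (m ` {l\<in>I. le i l})) (principal (m ` {l\<in>I. le j l}))"
      by (intro bexI[of _ k]) (simp_all only: inf_principal principal_le_iff)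
  qed
  also have "\<dots> \<longleftrightarrow> (\<exists>i\<in>I. \<forall>j\<in>I. le i j \<longrightarrow> Q (m j))"
    unfolding eventually_principal by blast
  finally show ?thesis .
qed

lemma tail_filter_proper:
  assumes "directed_set I le"
  shows "tail_filter I le m \<noteq> bot"
proof
  assume "tail_filter I le m = bot"
  then have "eventually (\<lambda>_. False) (tail_filter I le m)" by simp
  then obtain i where i: "i \<in> I" "\<forall>j\<in>I. \<not> le i j"
    unfolding eventually_tail_filter[OF assms] by blast
  moreover have "le i i" using assms i(1) by (simp add: directed_set_def)
  ultimately show False by blast
qed

lemma ex_net_tail_filter:
  fixes F :: "'x filter"
  assumes F: "F \<noteq> bot" and Q: "eventually Q F"
  shows "\<exists>I le (m :: 'x \<times> 'x set \<Rightarrow> 'x).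
    directed_set I le \<and> (\<forall>i\<in>I. Q (m i)) \<and> tail_filter I le m = F"
proof -
  define I where "I = {(x, U). x \<in> U \<and> (\<forall>x\<in>U. Q x) \<and> eventually (\<lambda>x. x \<in> U) F}"
  define le where "le = (\<lambda>(i :: 'x \<times> 'x set) (j :: 'x \<times> 'x set). snd j \<subseteq> snd i)"
  have ex: "\<exists>x. (x, U) \<in> I" if "eventually (\<lambda>x. x \<in> U) F" "\<forall>x\<in>U. Q x" for U
    using that eventually_happens'[OF F that(1)] by (auto simp: I_def)
  have "\<exists>k\<in>I. le i k \<and> le j k" if "i \<in> I" "j \<in> I" for i j
  proof -
    obtain x U y V where ij: "i = (x, U)" "j = (y, V)" by fastforce
    with that have "eventually (\<lambda>z. z \<in> U \<inter> V) F" "\<forall>z\<in>U \<inter> V. Q z"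
      by (simp_all add: I_def eventually_conj)
    from ex[OF this] obtain z where "(z, U \<inter> V) \<in> I" by blast
    moreover have "le i (z, U \<inter> V)" "le j (z, U \<inter> V)" by (simp_all add: le_def ij)
    ultimately show ?thesis by blast
  qed
  moreover have "I \<noteq> {}"
    using ex[of "{x. Q x}"] Q by fastforce
  moreover have "le i i" "le i j \<Longrightarrow> le j k \<Longrightarrow> le i k" for i j k
    by (simp_all add: le_def subset_trans[of "snd k"])
  ultimately have dir: "directed_set I le"
    unfolding directed_set_def by metis
  have "tail_filter I le fst = F"
  proof (rule filter_eqI)
    fix R
    show "eventually R (tail_filter I le fst) \<longleftrightarrow> eventually R F"
      unfolding eventually_tail_filter[OF dir]
    proof
      assume "\<exists>i\<in>I. \<forall>j\<in>I. le i j \<longrightarrow> R (fst j)"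
      then obtain x U where xU: "(x, U) \<in> I" and R: "\<And>j. j \<in> I \<Longrightarrow> le (x, U) j \<Longrightarrow> R (fst j)"
        by fastforce
      have "R y" if "y \<in> U" for y
        using R[of "(y, U)"] xU that by (auto simp: I_def le_def)
      with xU show "eventually R F"
        by (auto simp: I_def elim: eventually_mono)
    next
      assume R: "eventually R F"
      with Q have "eventually (\<lambda>x. x \<in> {x. Q x \<and> R x}) F" by (simp add: eventually_conj)
      from ex[OF this] obtain x where "(x, {x. Q x \<and> R x}) \<in> I" by auto
      then show "\<exists>i\<in>I. \<forall>j\<in>I. le i j \<longrightarrow> R (fst j)"
        by (rule bexI[rotated]) (auto simp: I_def le_def)
    qed
  qed
  moreover have "\<forall>i\<in>I. Q (fst i)" by (auto simp: I_def)
  ultimately show ?thesis using dir by blast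
qed

section \<open>Amenability notions\<close>

text \<open>Conditions imposed on all members of a net become conditions holding eventually along the
  filter.\<close>

definition strong_pseudo_amenable :: "'a :: complex_banach_algebra itself \<Rightarrow> bool"
  where "strong_pseudo_amenable _ \<longleftrightarrow>
    (let T = dual_bimodule (dual_bimodule (ptensor_bimodule :: ('a, ('a, 'a) ptensor) bimodule));
         A = dual_bimodule (dual_bimodule (self_bimodule :: ('a, 'a) bimodule));
         pi2 = cadjoint (cadjoint (ptensor_mult :: ('a, 'a) ptensor \<Rightarrow> 'a))
     in \<exists>F :: ('a, 'a) ptensor cdual cdual filter. F \<noteq> bot \<and>
          (\<forall>a. ((\<lambda>m. lact T a m - ract T a m) \<longlongrightarrow> 0) F) \<and>
          (\<forall>\<^sub>F m in F. \<forall>a. lact A a (pi2 m) = ract A a (pi2 m)) \<and>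
          (\<forall>a. ((\<lambda>m. ract A a (pi2 m)) \<longlongrightarrow> to_bidual a) F))"

definition strong_pseudo_Connes_amenable :: "'a :: complex_banach_algebra cdual set \<Rightarrow> bool"
  where "strong_pseudo_Connes_amenable P \<longleftrightarrow>
    (let S = sigma_wc_tensor P;
         D = dual_on_bimodule (dual_bimodule ptensor_bimodule) S
     in \<exists>F :: (('a, 'a) ptensor cdual \<Rightarrow> complex) filter. F \<noteq> bot \<and>
          (\<forall>\<^sub>F m in F. m \<in> dual_on S) \<and>
          (\<forall>a. limitin (weak_star_on S) (\<lambda>m. \<lambda>x\<in>S. lact D a m x - ract D a m x) (\<lambda>x\<in>S. 0) F) \<and>
          (\<forall>\<^sub>F m in F. \<forall>a. a * pi_sigma_wc P m = pi_sigma_wc P m * a) \<and>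
          (\<forall>a. limitin (predual_weak_star P) (\<lambda>m. a * pi_sigma_wc P m) a F))"

end

theory Submission
  imports Defs
begin

text \<open>
  The net witnessing strong pseudo-Connes amenability is the given net of the bidual
  \<open>(\<A> \<otimes> \<A>)\<^sup>*\<^sup>*\<close>, each member being restricted to \<open>S = \<sigma>wc((\<A> \<otimes> \<A>)\<^sup>*)\<close>.  Two facts
  make the restriction compatible with all the structure involved.

  First, \<open>S\<close> is a submodule of \<open>(\<A> \<otimes> \<A>)\<^sup>*\<close> (\<open>sigma_wc_submodule\<close>), because multiplication in \<open>\<A>\<close>
  is separately weak-star continuous, the predual being a submodule of \<open>\<A>\<^sup>*\<close>.  Hence restriction
  commutes with the module actions, and norm convergence of \<open>a \<cdot> m - m \<cdot> a\<close> to \<open>0\<close> gives pointwise,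
  that is weak-star, convergence on \<open>S\<close>.

  Second, \<open>\<pi>\<^sup>*\<close> maps the predual into \<open>S\<close> (\<open>cadjoint_ptensor_mult_sigma_wc\<close>).  The reason is that a
  functional \<open>f \<in> \<A>\<^sup>*\<^sup>*\<close> agrees on the predual with an element \<open>y\<close> of \<open>\<A>\<close>, so that for \<open>\<phi>\<close> in the
  predual \<open>f(a \<cdot> \<phi>) = \<phi>(y a) = (\<phi> \<cdot> y)(a)\<close> is weak-star continuous in \<open>a\<close>.  Therefore \<open>\<pi>\<^sub>\<sigma>\<^sub>w\<^sub>c\<close> of the
  restriction of \<open>m\<close> is the element of \<open>\<A>\<close> that represents \<open>\<pi>\<^sup>*\<^sup>*(m)\<close> on the predual
  (\<open>capply_pi_sigma_wc\<close>).  As the predual separates the points of \<open>\<A>\<close>, centrality of \<open>\<pi>\<^sup>*\<^sup>*(m)\<close>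
  passes to that element, and norm convergence of \<open>\<pi>\<^sup>*\<^sup>*(m) \<cdot> a\<close> becomes weak-star convergence.
\<close>

section \<open>Initial topologies\<close>

lemma topspace_initial_topology [simp]: "topspace (initial_topology X I ev) = X"
  unfolding initial_topology_def by (auto simp: topspace_pullback_topology)

lemma continuous_map_eval_initial_topology:
  assumes "i \<in> I"
  shows "continuous_map (initial_topology X I ev) euclidean (ev i)"
proof -
  have "continuous_map (initial_topology X I ev) euclidean
      ((\<lambda>h. h i) \<circ> (\<lambda>x. \<lambda>j\<in>I. ev j x))"
    unfolding initial_topology_def
    by (rule continuous_map_pullback[OF continuous_map_product_projection[OF assms]])
  moreover have "(\<lambda>h. h i) \<circ> (\<lambda>x. \<lambda>j\<in>I. ev j x) = ev i"
    using assms by auto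
  ultimately show ?thesis by simp
qed

lemma continuous_map_into_initial_topology:
  assumes "f \<in> topspace Y \<rightarrow> X" "\<And>i. i \<in> I \<Longrightarrow> continuous_map Y euclidean (\<lambda>y. ev i (f y))"
  shows "continuous_map Y (initial_topology X I ev) f"
  unfolding initial_topology_def
proof (rule continuous_map_pullback')
  show "continuous_map Y (product_topology (\<lambda>_. euclidean) I) ((\<lambda>x. \<lambda>i\<in>I. ev i x) \<circ> f)"
    using assms(2) by (auto simp: continuous_map_componentwise)
  show "topspace Y \<subseteq> f -` X" using assms(1) by auto
qed

lemma limitin_initial_topology:
  assumes "l \<in> X" "\<forall>\<^sub>F m in F. f m \<in> X" "\<And>i. i \<in> I \<Longrightarrow> ((\<lambda>m. ev i (f m)) \<longlongrightarrow> ev i l) F"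
  shows "limitin (initial_topology X I ev) f l F"
  unfolding limitin_def
proof (intro conjI allI impI)
  show "l \<in> topspace (initial_topology X I ev)" using assms(1) by simp
  fix U assume U: "openin (initial_topology X I ev) U \<and> l \<in> U"
  let ?e = "\<lambda>x. \<lambda>i\<in>I. ev i x"
  from U obtain V where V: "openin (product_topology (\<lambda>_. euclidean) I) V" "U = ?e -` V \<inter> X"
    unfolding initial_topology_def openin_pullback_topology by blast
  have "limitin (product_topology (\<lambda>_. euclidean) I) (\<lambda>m. ?e (f m)) (?e l) F"
    using assms(3) by (auto simp: limitin_componentwise)
  moreover have "?e l \<in> V" using U V(2) by simp
  ultimately have "\<forall>\<^sub>F m in F. ?e (f m) \<in> V" using V(1) unfolding limitin_def by blast
  with assms(2) show "\<forall>\<^sub>F m in F. f m \<in> U"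
    by eventually_elim (simp add: V(2))
qed

text \<open>A bounded operator is weakly continuous because a functional composed with it is again a
  functional, namely its image under the adjoint.\<close>

lemma continuous_map_weak_bounded_clinear:
  assumes T: "bounded_clinear T" and f: "continuous_map Y weak_topology f"
  shows "continuous_map Y weak_topology (\<lambda>y. T (f y))"
proof (rule continuous_map_into_initial_topology)
  fix \<psi>
  have "continuous_map Y euclidean (capply (cadjoint T \<psi>) \<circ> f)"
    by (rule continuous_map_compose[OF f continuous_map_eval_initial_topology]) simp
  then show "continuous_map Y euclidean (\<lambda>y. capply \<psi> (T (f y)))"
    by (simp add: comp_def capply_cadjoint[OF T])
qed simp

section \<open>Bimodule actions\<close>

lemma capply_lact_dual_self:
  "capply (lact (dual_bimodule self_bimodule) a \<phi>) x = capply \<phi> (x * a)"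
  unfolding dual_bimodule_def self_bimodule_def
  by (simp add: capply_cadjoint bounded_cbilinearD(5)[OF bounded_cbilinear_mult_flip])

lemma capply_ract_dual_self:
  "capply (ract (dual_bimodule self_bimodule) a \<phi>) x = capply \<phi> (a * x)"
  unfolding dual_bimodule_def self_bimodule_def
  by (simp add: capply_cadjoint bounded_cbilinearD(5)[OF bounded_cbilinear_mult])

lemma banach_bimodule_clinear:
  assumes "banach_bimodule M"
  shows "bounded_clinear (lact M a)" "bounded_clinear (ract M a)"
  using assms unfolding banach_bimodule_def by (auto intro: bounded_cbilinearD(5))

lemma capply_dual_bimodule:
  assumes "banach_bimodule M"
  shows "capply (lact (dual_bimodule M) a \<phi>) x = capply \<phi> (ract M a x)"
    "capply (ract (dual_bimodule M) a \<phi>) x = capply \<phi> (lact M a x)"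
  unfolding dual_bimodule_def
  by (simp_all add: capply_cadjoint banach_bimodule_clinear[OF assms])

lemma bounded_clinear_ptensor_mult: "bounded_clinear ptensor_mult"
  and ptensor_mult_tens: "ptensor_mult (tens a b) = a * b"
  unfolding ptensor_mult_def by (simp_all add: ptensor_lift bounded_cbilinear_mult)

lemma ptensor_mult_actions:
  "ptensor_mult (lact ptensor_bimodule a t) = a * ptensor_mult t"
  "ptensor_mult (ract ptensor_bimodule a t) = ptensor_mult t * a"
proof -
  note c = bounded_clinear_compose[OF bounded_clinear_ptensor_mult ptensor_bimodule_clinear(1)]
    bounded_clinear_compose[OF bounded_clinear_ptensor_mult ptensor_bimodule_clinear(2)]
    bounded_clinear_compose[OF bounded_cbilinearD(5)[OF bounded_cbilinear_mult]
      bounded_clinear_ptensor_mult]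
    bounded_clinear_compose[OF bounded_cbilinearD(5)[OF bounded_cbilinear_mult_flip]
      bounded_clinear_ptensor_mult]
  show "ptensor_mult (lact ptensor_bimodule a t) = a * ptensor_mult t"
    by (rule fun_cong[OF ptensor_ext[OF c(1) c(3)]])
      (simp add: ptensor_bimodule_tens ptensor_mult_tens mult.assoc)
  show "ptensor_mult (ract ptensor_bimodule a t) = ptensor_mult t * a"
    by (rule fun_cong[OF ptensor_ext[OF c(2) c(4)]])
      (simp add: ptensor_bimodule_tens ptensor_mult_tens mult.assoc)
qed

lemma cadjoint_ptensor_mult_actions:
  "lact (dual_bimodule ptensor_bimodule) a (cadjoint ptensor_mult \<phi>) =
    cadjoint ptensor_mult (lact (dual_bimodule self_bimodule) a \<phi>)"
  "ract (dual_bimodule ptensor_bimodule) a (cadjoint ptensor_mult \<phi>) =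
    cadjoint ptensor_mult (ract (dual_bimodule self_bimodule) a \<phi>)"
  by (auto intro!: cdual_eqI simp: capply_dual_bimodule[OF banach_bimodule_ptensor]
      capply_cadjoint[OF bounded_clinear_ptensor_mult] ptensor_mult_actions
      capply_lact_dual_self capply_ract_dual_self)

section \<open>Restriction of functionals to a subspace\<close>

lemma capply_linear:
  "capply f (x + y) = capply f x + capply f y" "capply f (c *\<^sub>C x) = c * capply f x"
  using bounded_clinearD[OF bounded_clinear_capply, of f] by (simp_all add: scaleC_complex_def)

lemma restrict_capply_dual_on:
  assumes "csubspace S"
  shows "(\<lambda>x\<in>S. capply f x) \<in> dual_on S"
  using assms norm_capply[of f] unfolding dual_on_def csubspace_def
  by (auto simp: capply_linear)

section \<open>The predual and the weak-star continuous part\<close>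

lemma predual_submodule:
  assumes "dual_banach_algebra P" "\<phi> \<in> P"
  shows "lact (dual_bimodule self_bimodule) a \<phi> \<in> P" "ract (dual_bimodule self_bimodule) a \<phi> \<in> P"
  using assms by (simp_all add: dual_banach_algebra_def)

lemma predual_separates:
  assumes P: "dual_banach_algebra P" and eq: "\<And>\<phi>. \<phi> \<in> P \<Longrightarrow> capply \<phi> x = capply \<phi> y"
  shows "x = y"
proof -
  have "predual_map P x = predual_map P y" unfolding predual_map_def using eq by auto
  with P show ?thesis by (auto simp: dual_banach_algebra_def bij_betw_def inj_on_def)
qed

lemma predual_represents:
  assumes P: "dual_banach_algebra P" and m: "m \<in> dual_on P" and \<phi>: "\<phi> \<in> P"
  shows "capply \<phi> (the_inv (predual_map P) m) = m \<phi>"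
proof -
  have "predual_map P (the_inv (predual_map P) m) = m"
    using P m by (intro f_the_inv_into_f) (auto simp: dual_banach_algebra_def bij_betw_def)
  from fun_cong[OF this, of \<phi>] \<phi> show ?thesis by (simp add: predual_map_def)
qed

text \<open>Multiplication is separately weak-star continuous since its adjoints are the module actions
  on the predual.\<close>

lemma continuous_map_predual_mult:
  assumes P: "dual_banach_algebra P"
  shows "continuous_map (predual_weak_star P) (predual_weak_star P) (\<lambda>a. a * b)"
    "continuous_map (predual_weak_star P) (predual_weak_star P) (\<lambda>a. b * a)"
proof -
  have "continuous_map (predual_weak_star P) euclidean (\<lambda>a. capply \<phi> (a * b))"
    "continuous_map (predual_weak_star P) euclidean (\<lambda>a. capply \<phi> (b * a))" if "\<phi> \<in> P" for \<phi>
    using predual_submodule[OF P that, of b]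
    by (auto dest!: continuous_map_eval_initial_topology[where X = UNIV and ev = capply]
        simp: capply_lact_dual_self[abs_def] capply_ract_dual_self[abs_def])
  then show "continuous_map (predual_weak_star P) (predual_weak_star P) (\<lambda>a. a * b)"
    "continuous_map (predual_weak_star P) (predual_weak_star P) (\<lambda>a. b * a)"
    by (auto intro!: continuous_map_into_initial_topology)
qed

lemma sigma_wc_csubspace:
  assumes M: "banach_bimodule M"
  shows "csubspace (sigma_wc P M)"
proof -
  have char: "x \<in> sigma_wc P M \<longleftrightarrow>
     (\<forall>\<psi>. continuous_map (predual_weak_star P) euclidean (\<lambda>a. capply \<psi> (lact M a x)) \<and>
          continuous_map (predual_weak_star P) euclidean (\<lambda>a. capply \<psi> (ract M a x)))" for x
    unfolding sigma_wc_def mem_Collect_eq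
    using continuous_map_compose[OF _ continuous_map_eval_initial_topology[of _ UNIV UNIV capply]]
    by (auto intro!: continuous_map_into_initial_topology simp: comp_def)
  note D = bounded_clinearD[OF banach_bimodule_clinear(1)[OF M]]
    bounded_clinearD[OF banach_bimodule_clinear(2)[OF M]]
  have zero: "lact M a 0 = 0" "ract M a 0 = 0" for a
    using D(2)[of a 0 0] D(4)[of a 0 0] by simp_all
  have z: "capply \<psi> 0 = 0" for \<psi> :: "'b cdual"
    using capply_linear(2)[of \<psi> 0 0] by simp
  have scale: "continuous_map Y euclidean (\<lambda>a. c * g a)"
    if "continuous_map Y euclidean g" for Y :: "'a topology" and c and g :: "'a \<Rightarrow> complex"
    using continuous_map_compose[OF that, of euclidean "(*) c"]
    by (simp add: comp_def continuous_on_mult_left)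
  show ?thesis
    unfolding csubspace_def
    by (auto simp: char D zero z capply_linear intro!: continuous_map_add scale)
qed

text \<open>For \<open>b \<cdot> x\<close>, the left orbit map is that of \<open>x\<close> preceded by \<open>a \<mapsto> a b\<close>, and the right
  orbit map is that of \<open>x\<close> followed by the bounded operator \<open>b \<cdot> _\<close>; both modifications preserve
  weak-star to weak continuity.  The element \<open>x \<cdot> b\<close> is treated symmetrically.\<close>

lemma sigma_wc_submodule:
  assumes P: "dual_banach_algebra P" and M: "banach_bimodule M" and x: "x \<in> sigma_wc P M"
  shows "lact M b x \<in> sigma_wc P M" "ract M b x \<in> sigma_wc P M"
proof -
  have c: "continuous_map (predual_weak_star P) weak_topology (\<lambda>a. lact M a x)"
    "continuous_map (predual_weak_star P) weak_topology (\<lambda>a. ract M a x)"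
    using x by (auto simp: sigma_wc_def)
  have ract_lact: "ract M a (lact M b x) = lact M b (ract M a x)"
    and lact_lact: "lact M a (lact M b x) = lact M (a * b) x"
    and ract_ract: "ract M a (ract M b x) = ract M (b * a) x"
    and lact_ract: "lact M a (ract M b x) = ract M b (lact M a x)" for a
    using M by (simp_all add: banach_bimodule_def)
  note comp = continuous_map_compose[OF continuous_map_predual_mult(1)[OF P] c(1), unfolded comp_def]
    continuous_map_compose[OF continuous_map_predual_mult(2)[OF P] c(2), unfolded comp_def]
  note op = continuous_map_weak_bounded_clinear[OF banach_bimodule_clinear(1)[OF M] c(2)]
    continuous_map_weak_bounded_clinear[OF banach_bimodule_clinear(2)[OF M] c(1)]
  show "lact M b x \<in> sigma_wc P M"
    using comp(1) op(1) by (simp add: sigma_wc_def ract_lact lact_lact)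
  show "ract M b x \<in> sigma_wc P M"
    using comp(2) op(2) by (simp add: sigma_wc_def ract_ract lact_ract)
qed

text \<open>Weak continuity concerns every functional \<open>f\<close> on the dual of the algebra, but the orbits of
  \<open>\<phi>\<close> stay in the predual, where \<open>f\<close> is evaluation at a point \<open>y\<close>.  Then \<open>f(a \<cdot> \<phi>) = (\<phi> \<cdot> y)(a)\<close>
  and \<open>f(\<phi> \<cdot> a) = (y \<cdot> \<phi>)(a)\<close>, and \<open>\<phi> \<cdot> y\<close> and \<open>y \<cdot> \<phi>\<close> lie in the predual.\<close>

lemma predual_sigma_wc:
  assumes P: "dual_banach_algebra P" and \<phi>: "\<phi> \<in> P"
  shows "\<phi> \<in> sigma_wc P (dual_bimodule self_bimodule)"
proof -
  have "continuous_map (predual_weak_star P) euclidean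
        (\<lambda>a. capply f (lact (dual_bimodule self_bimodule) a \<phi>))"
    "continuous_map (predual_weak_star P) euclidean
        (\<lambda>a. capply f (ract (dual_bimodule self_bimodule) a \<phi>))" for f
  proof -
    \<comment> \<open>the element of the algebra that represents \<open>f\<close> on the predual\<close>
    define y where "y = the_inv (predual_map P) (\<lambda>\<theta>\<in>P. capply f \<theta>)"
    have "csubspace P" using P by (simp add: dual_banach_algebra_def)
    then have "capply f \<theta> = capply \<theta> y" if "\<theta> \<in> P" for \<theta>
      using predual_represents[OF P restrict_capply_dual_on that] that by (simp add: y_def)
    then have "capply f (lact (dual_bimodule self_bimodule) a \<phi>) =
          capply (ract (dual_bimodule self_bimodule) y \<phi>) a"
      "capply f (ract (dual_bimodule self_bimodule) a \<phi>) =
          capply (lact (dual_bimodule self_bimodule) y \<phi>) a" for a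
      by (simp_all add: predual_submodule[OF P \<phi>] capply_lact_dual_self capply_ract_dual_self)
    then show "continuous_map (predual_weak_star P) euclidean
        (\<lambda>a. capply f (lact (dual_bimodule self_bimodule) a \<phi>))"
      "continuous_map (predual_weak_star P) euclidean
        (\<lambda>a. capply f (ract (dual_bimodule self_bimodule) a \<phi>))"
      using continuous_map_eval_initial_topology[OF predual_submodule(1)[OF P \<phi>, of y]]
        continuous_map_eval_initial_topology[OF predual_submodule(2)[OF P \<phi>, of y]]
      by (simp_all add: eta_contract_eq)
  qed
  then show ?thesis
    by (auto simp: sigma_wc_def intro!: continuous_map_into_initial_topology)
qed

lemma bounded_clinear_cadjoint:
  assumes T: "bounded_clinear T"
  shows "bounded_clinear (cadjoint T)"
proof -
  obtain K where K: "K \<ge> 0" "\<And>x. norm (T x) \<le> norm x * K"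
    using T bounded_linear.nonneg_bounded unfolding bounded_clinear_def by blast
  show ?thesis
  proof (rule bounded_clinearI[where K = K])
    fix \<phi>
    have "cmod (capply \<phi> (T x)) \<le> norm \<phi> * (norm x * K)" for x
      by (rule order_trans[OF norm_capply mult_left_mono[OF K(2)]]) simp
    then show "norm (cadjoint T \<phi>) \<le> norm \<phi> * K"
      using K(1) by (intro norm_cdual_bound) (simp_all add: capply_cadjoint[OF T] mult_ac)
  qed (auto intro!: cdual_eqI simp: capply_cadjoint[OF T])
qed

text \<open>As \<open>\<pi>\<^sup>*\<close> is a bounded module morphism, it carries the weak continuity of the orbit maps of
  \<open>\<phi>\<close> over to those of \<open>\<pi>\<^sup>*(\<phi>)\<close>.\<close>

lemma cadjoint_ptensor_mult_sigma_wc: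
  assumes P: "dual_banach_algebra P" and \<phi>: "\<phi> \<in> P"
  shows "cadjoint ptensor_mult \<phi> \<in> sigma_wc_tensor P"
  using predual_sigma_wc[OF P \<phi>]
  by (auto simp: sigma_wc_def cadjoint_ptensor_mult_actions
      intro!: continuous_map_weak_bounded_clinear[OF
        bounded_clinear_cadjoint[OF bounded_clinear_ptensor_mult]])

lemma capply_pi_sigma_wc:
  assumes P: "dual_banach_algebra P" and \<phi>: "\<phi> \<in> P"
  shows "capply \<phi> (pi_sigma_wc P (\<lambda>x\<in>sigma_wc_tensor P. capply m x)) =
    capply (cadjoint (cadjoint ptensor_mult) m) \<phi>"
proof -
  note c = capply_cadjoint[OF bounded_clinear_cadjoint[OF bounded_clinear_ptensor_mult]]
  have eq: "(\<lambda>\<theta>\<in>P. (\<lambda>x\<in>sigma_wc_tensor P. capply m x) (cadjoint ptensor_mult \<theta>)) =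
      (\<lambda>\<theta>\<in>P. capply (cadjoint (cadjoint ptensor_mult) m) \<theta>)"
    by (rule restrict_ext) (simp add: c cadjoint_ptensor_mult_sigma_wc[OF P])
  have "csubspace P" using P by (simp add: dual_banach_algebra_def)
  from predual_represents[OF P restrict_capply_dual_on[OF this] \<phi>] \<phi> show ?thesis
    unfolding pi_sigma_wc_def eq by simp
qed

section \<open>Restricting the net\<close>

theorem proposition2p7:
  fixes P :: "'a :: complex_banach_algebra cdual set"
  assumes "dual_banach_algebra P"
    and "strong_pseudo_amenable TYPE('a)"
  shows "strong_pseudo_Connes_amenable P"
proof -
  note P = assms(1)
  define S where "S = sigma_wc_tensor P"
  define M where "M = dual_bimodule (ptensor_bimodule :: ('a, ('a, 'a) ptensor) bimodule)"
  define A where "A = dual_bimodule (self_bimodule :: ('a, 'a) bimodule)"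
  define pi2 where "pi2 = cadjoint (cadjoint (ptensor_mult :: ('a, 'a) ptensor \<Rightarrow> 'a))"
  define q where "q = (\<lambda>m :: ('a, 'a) ptensor cdual cdual. \<lambda>x\<in>S. capply m x)"
  have M: "banach_bimodule M"
    unfolding M_def by (intro banach_bimodule_dual banach_bimodule_ptensor)
  have S: "csubspace S" "\<And>a x. x \<in> S \<Longrightarrow> lact M a x \<in> S" "\<And>a x. x \<in> S \<Longrightarrow> ract M a x \<in> S"
    using sigma_wc_csubspace[OF M] sigma_wc_submodule[OF P M] by (simp_all add: S_def M_def)
  obtain F :: "('a, 'a) ptensor cdual cdual filter" where F: "F \<noteq> bot"
    and comm: "\<And>a. ((\<lambda>m. lact (dual_bimodule M) a m - ract (dual_bimodule M) a m) \<longlongrightarrow> 0) F"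
    and central: "\<forall>\<^sub>F m in F. \<forall>a. lact (dual_bimodule A) a (pi2 m) = ract (dual_bimodule A) a (pi2 m)"
    and unit: "\<And>a. ((\<lambda>m. ract (dual_bimodule A) a (pi2 m)) \<longlongrightarrow> to_bidual a) F"
    using assms(2) unfolding strong_pseudo_amenable_def Let_def M_def A_def pi2_def by blast
  have tendsto_capply: "((\<lambda>m. capply (f m) x) \<longlongrightarrow> capply l x) F"
    if "(f \<longlongrightarrow> l) F" for x and f :: "_ \<Rightarrow> 'e :: complex_normed_vector cdual" and l
    using that bounded_linear.tendsto[of "\<lambda>g. capply g x"]
      bounded_clinear_capply[of "to_bidual x"]
    by (simp add: bounded_clinear_def capply_to_bidual[abs_def])
  have q_dual: "q m \<in> dual_on S" for m
    unfolding q_def by (rule restrict_capply_dual_on[OF S(1)])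
  have q_actions: "(\<lambda>x\<in>S. lact (dual_on_bimodule M S) a (q m) x - ract (dual_on_bimodule M S) a (q m) x)
      = q (lact (dual_bimodule M) a m - ract (dual_bimodule M) a m)" for a m
    by (rule ext) (auto simp: q_def dual_on_bimodule_def S capply_dual_bimodule[OF M])
  have q_0: "(\<lambda>x\<in>S. 0) = q 0" by (auto simp: q_def)
  have pi_mult: "capply \<phi> (a * pi_sigma_wc P (q m)) = capply (lact (dual_bimodule A) a (pi2 m)) \<phi>"
    "capply \<phi> (pi_sigma_wc P (q m) * a) = capply (ract (dual_bimodule A) a (pi2 m)) \<phi>"
    if "\<phi> \<in> P" for \<phi> a m
    using capply_pi_sigma_wc[OF P predual_submodule(1)[OF P that], of a m]
      capply_pi_sigma_wc[OF P predual_submodule(2)[OF P that], of a m]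
    by (simp_all add: q_def S_def pi2_def A_def
        capply_dual_bimodule[OF banach_bimodule_dual[OF banach_bimodule_self]] capply_lact_dual_self capply_ract_dual_self)
  have comm': "limitin (weak_star_on S)
      (\<lambda>m. \<lambda>x\<in>S. lact (dual_on_bimodule M S) a m x - ract (dual_on_bimodule M S) a m x)
      (\<lambda>x\<in>S. 0) (filtermap q F)" for a
  proof -
    have "limitin (weak_star_on S) (\<lambda>m. q (lact (dual_bimodule M) a m - ract (dual_bimodule M) a m)) (q 0) F"
      using tendsto_capply[OF comm[of a]]
      by (intro limitin_initial_topology) (auto simp: q_dual, simp add: q_def)
    then show ?thesis
      by (simp add: limitin_def eventually_filtermap q_actions q_0)
  qed
  have central': "\<forall>\<^sub>F m in F. \<forall>a. a * pi_sigma_wc P (q m) = pi_sigma_wc P (q m) * a"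
    using central by eventually_elim (auto intro!: predual_separates[OF P] simp: pi_mult)
  have unit': "limitin (predual_weak_star P) (\<lambda>m. a * pi_sigma_wc P m) a (filtermap q F)" for a
  proof -
    have "limitin (predual_weak_star P) (\<lambda>m. a * pi_sigma_wc P (q m)) a F"
    proof (rule limitin_initial_topology)
      fix \<phi> assume \<phi>: "\<phi> \<in> P"
      have "((\<lambda>m. capply (ract (dual_bimodule A) a (pi2 m)) \<phi>) \<longlongrightarrow> capply \<phi> a) F"
        using tendsto_capply[OF unit[of a], of \<phi>] by (simp add: capply_to_bidual)
      \<comment> \<open>the hypothesis multiplies by \<open>a\<close> on the other side, so centrality is used here\<close>
      moreover have "\<forall>\<^sub>F m in F. capply (ract (dual_bimodule A) a (pi2 m)) \<phi> =
          capply \<phi> (a * pi_sigma_wc P (q m))"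
        using central by eventually_elim (simp add: pi_mult[OF \<phi>])
      ultimately show "((\<lambda>m. capply \<phi> (a * pi_sigma_wc P (q m))) \<longlongrightarrow> capply \<phi> a) F"
        by (rule Lim_transform_eventually)
    qed simp_all
    then show ?thesis by (simp add: limitin_def eventually_filtermap)
  qed
  show ?thesis
    unfolding strong_pseudo_Connes_amenable_def Let_def M_def[symmetric]
      S_def[folded M_def, symmetric]
    using F q_dual comm' central' unit'
    by (intro exI[of _ "filtermap q F"]) (auto simp: filtermap_bot_iff eventually_filtermap)
qed

end
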